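(* Let $\mathcal{K}^n$ be the chromatic derivatives associated with the (rescaled and normalized) Legendre polynomials, and let $f,g\in\mathbf{BL}(\pi)$. Then the following sums do not depend on $t\in\mathbb{R}$ and satisfy (the last one for every $u\in\mathbb{R}$) $$\sum_{n=0}^{\infty}\mathcal{K}^n[f](t)^2=\int_{-\infty}^{\infty}f(x)^2\,dx;$$ $$\sum_{n=0}^{\infty}\mathcal{K}^n[f](t)\,\mathcal{K}^n[g](t)=\int_{-\infty}^{\infty}f(x)g(x)\,dx;$$ $$\sum_{n=0}^{\infty}\mathcal{K}^n[f](t)\,\mathcal{K}^n_t[g(u-t)]=\int_{-\infty}^{\infty}f(x)g(u-x)\,dx.$$
   Context: $\mathbf{BL}(\pi)$ is the Hilbert space of real valued continuous $L^2(\mathbb{R})$ functions whose Fourier transform is supported in $[-\pi,\pi]$, with the usual scalar product; such functions are restrictions to $\mathbb{R}$ of entire functions. Let $p^L_n(\omega)=\sqrt{2n+1}\,P_n(\omega/\pi)$, where $P_n$ are the Legendre polynomials, so that $\frac{1}{2\pi}\int_{-\pi}^{\pi}p^L_n(\omega)p^L_m(\omega)\,d\omega=\delta(m-n)$, where $\delta(0)=1$ and $\delta(k)=0$ for $k\ne0$. The chromatic derivatives associated with the Legendre polynomials are the differential operators (with real coefficients) $\mathcal{K}^n_t=\mathrm{i}^n p^L_n\left(-\mathrm{i}\frac{d}{dt}\right)$, i.e. $\omega^k$ in $p_n^L(\omega)$ is replaced by $(-\mathrm{i})^k\,d^k/dt^k$ and the result is multiplied by $\mathrm{i}^n$. The subscript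 indicates the variable of differentiation and is dropped when the operator is applied to a function of a single variable. *)

theory Defs
  imports "HOL-Analysis.Analysis" "HOL-Computational_Algebra.Polynomial"
begin

text \<open>Legendre polynomials, by Rodrigues' formula.\<close>

definition legendre :: "nat \<Rightarrow> real poly" where
  "legendre n = smult (1 / (2 ^ n * fact n)) ((pderiv ^^ n) ([:- 1, 0, 1:] ^ n))"

definition legendre_normalized :: "nat \<Rightarrow> real poly" where
  "legendre_normalized n = smult (sqrt (2 * real n + 1)) (pcompose (legendre n) [:0, 1 / pi:])"

text \<open>
  The operator is complex-valued only because the powers of the imaginary unit are kept literally;
  its coefficients are real, see \<open>chromatic_derivative_real\<close> below.
\<close>

definition chromatic_derivative :: "nat \<Rightarrow> (real \<Rightarrow> real) \<Rightarrow> real \<Rightarrow> complex" where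
  "chromatic_derivative n f t =
     \<i> ^ n * (\<Sum>k\<le>degree (legendre_normalized n).
       of_real (coeff (legendre_normalized n) k) * (- \<i>) ^ k * of_real ((deriv ^^ k) f t))"

text \<open>
  The Fourier transform, with kernel \<open>e\<^sup>-\<^sup>i\<^sup>\<omega>\<^sup>x\<close>, of a square integrable function need not exist as an
  absolutely convergent integral; it is the limit in the square mean of the transforms of the
  truncations to \<open>[-R, R]\<close>, and is determined up to a null set.
  The distance is a nonnegative integral, so that no convention about non-integrable
  functions enters.
\<close>

definition truncated_fourier :: "(real \<Rightarrow> real) \<Rightarrow> real \<Rightarrow> real \<Rightarrow> complex" where
  "truncated_fourier f R \<omega> =
     (LINT x:{-R..R}|lborel. of_real (f x) * exp (- \<i> * of_real (\<omega> * x)))"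

definition has_L2_fourier_transform :: "(real \<Rightarrow> real) \<Rightarrow> (real \<Rightarrow> complex) \<Rightarrow> bool" where
  "has_L2_fourier_transform f F \<longleftrightarrow>
     F \<in> borel_measurable lborel \<and>
     integrable lborel (\<lambda>\<omega>. (cmod (F \<omega>))\<^sup>2) \<and>
     ((\<lambda>R. \<integral>\<^sup>+ \<omega>. ennreal ((cmod (truncated_fourier f R \<omega> - F \<omega>))\<^sup>2) \<partial>lborel) \<longlongrightarrow> 0) at_top"

definition BL_pi :: "(real \<Rightarrow> real) set" where
  "BL_pi = {f. continuous_on UNIV f \<and> integrable lborel (\<lambda>x. (f x)\<^sup>2) \<and>
     (\<exists>F. has_L2_fourier_transform f F \<and> (AE \<omega> in lborel. \<omega> \<notin> {-pi..pi} \<longrightarrow> F \<omega> = 0))}"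

lemma pderiv_funpow_reflect:
  "(pderiv ^^ n) (pcompose q [:0, -1:]) = smult ((- 1) ^ n) (pcompose ((pderiv ^^ n) q) [:0, -1 :: real:])"
  by (induction n) (simp_all add: pderiv_pcompose pderiv_smult pderiv_pCons)

lemma coeff_legendre_parity: "coeff (legendre n) k * (- 1) ^ k = (- 1) ^ n * coeff (legendre n) k"
proof -
  have sq: "pcompose ([:- 1, 0, 1:] ^ n) [:0, -1 :: real:] = [:- 1, 0, 1:] ^ n"
    by (induction n) (simp_all add: pcompose_mult pcompose_pCons pcompose_1 del: mult_pCons_left)
  define D where "D = (pderiv ^^ n) ([:- 1, 0, 1 :: real:] ^ n)"
  have "D = smult ((- 1) ^ n) (pcompose D [:0, -1:])"
    using pderiv_funpow_reflect[of n "[:- 1, 0, 1:] ^ n"] by (simp add: sq D_def)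
  from arg_cong[OF this, of "smult ((- 1) ^ n)"] have "pcompose D [:0, -1:] = smult ((- 1) ^ n) D"
    by (simp flip: power_mult_distrib)
  then have "pcompose (legendre n) [:0, -1:] = smult ((- 1) ^ n) (legendre n)"
    by (simp add: legendre_def pcompose_smult flip: D_def)
  from arg_cong[OF this, of "\<lambda>p. coeff p k"] show ?thesis
    by (simp add: coeff_pcompose_linear mult.commute)
qed

lemma chromatic_derivative_real: "chromatic_derivative n f t \<in> \<real>"
proof -
  have "\<i> ^ n * (of_real (coeff (legendre_normalized n) k) * (- \<i>) ^ k) \<in> \<real>" for k
  proof (cases "coeff (legendre n) k = 0")
    case True
    then show ?thesis by (simp add: legendre_normalized_def coeff_pcompose_linear)
  next
    case False
    with coeff_legendre_parity[of n k] have "(- 1 :: real) ^ k = (- 1) ^ n" by simp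
    then have "even n \<longleftrightarrow> even k"
      by (metis neg_one_even_power neg_one_odd_power one_neq_neg_one)
    then have "even (n + k)" by simp
    then obtain m where m: "n + k = 2 * m" by (elim evenE)
    have "\<i> ^ n * (- \<i>) ^ k = (- 1) ^ k * \<i> ^ (n + k)"
      by (simp add: power_add power_minus[of \<i>])
    also have "\<dots> = (- 1) ^ k * (- 1) ^ m"
      unfolding m by (simp add: power_mult)
    finally have "\<i> ^ n * (- \<i>) ^ k \<in> \<real>"
      by (metis Reals_1 Reals_minus Reals_mult Reals_power)
    then show ?thesis
      by (metis Reals_mult Reals_of_real mult.left_commute)
  qed
  then show ?thesis
    unfolding chromatic_derivative_def sum_distrib_left
    by (intro sum_in_Reals) (metis Reals_mult Reals_of_real mult.assoc)
qed

end

theory Submission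
  imports Defs "HOL-Probability.Characteristic_Functions"
begin

text \<open>
  Let \<open>F\<close> be the Fourier transform of \<open>f\<close>; it vanishes outside \<open>[-\<pi>, \<pi>]\<close>. Differentiating the
  inversion formula \<open>2\<pi> f(t) = \<integral> F(\<omega>) e\<^sup>i\<^sup>\<omega>\<^sup>t d\<omega>\<close> under the integral sign turns the \<open>n\<close>-th chromatic
  derivative into a Legendre coefficient: \<open>K\<^sup>n[f](t)\<close> is \<open>\<i>\<^sup>n\<close> times the inner product, in the
  space of square integrable functions on \<open>[-\<pi>, \<pi>]\<close> with normalized measure, of \<open>F(\<omega>) e\<^sup>i\<^sup>\<omega>\<^sup>t\<close> and
  the \<open>n\<close>-th normalized Legendre polynomial (\<open>chromatic_derivative_band\<close>). These polynomials form a
  complete orthonormal system, so Parseval's identity gives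
  \<open>\<Sum>\<^sub>n |K\<^sup>n[f](t)|\<^sup>2 = 1/(2\<pi>) \<integral> |F|\<^sup>2\<close>; the factor \<open>e\<^sup>i\<^sup>\<omega>\<^sup>t\<close> has modulus one, which is why \<open>t\<close> drops
  out. Plancherel's identity equates the right-hand side with \<open>\<integral> f\<^sup>2\<close>. As the chromatic derivatives are
  real, this is the first identity (\<open>chromatic_energy\<close>). The second follows by polarization, and the
  third is the second one for \<open>f\<close> and the band-limited function \<open>s \<mapsto> g(u - s)\<close>.

  The analytic work lies in Plancherel's identity, in the inversion formula and in completeness. All
  three rest on approximating the pair \<open>(f, F)\<close> in the square mean by pairs \<open>(h, h^)\<close> with \<open>h\<close>
  bounded, of bounded support and with finitely many discontinuities, \<open>h^\<close> being its
  transform; for the truncations of \<open>f\<close> this is the definition of the transform.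

  \<^item> For such functions the polarized Plancherel identity (\<open>plancherel_tame\<close>) is obtained by inserting
    a Gaussian factor, exchanging the integrals, and letting the Gaussian tend to the constant one.
    It passes to the limit \<open>(f, F)\<close>.
  \<^item> Testing the limit against the indicator function of an interval shows that \<open>2\<pi> f\<close> and
    \<open>\<integral> F(\<omega>) e\<^sup>i\<^sup>\<omega>\<^sup>t d\<omega>\<close> have equal integrals over all intervals. Both are continuous, hence equal
    (\<open>band_inversion\<close>).
  \<^item> Completeness enters through the function \<open>F(\<omega>) e\<^sup>i\<^sup>\<omega>\<^sup>t\<close>. The transforms \<open>h^\<close> are continuous,
    so this function is a limit in the square mean of continuous ones, and these are approximated uniformly on
    \<open>[-\<pi>, \<pi>]\<close> by polynomials (\<open>legendre_parseval\<close>).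
\<close>

section \<open>Square integrable functions\<close>

definition square_integrable :: "'a measure \<Rightarrow> ('a \<Rightarrow> 'b::{banach,real_normed_field,second_countable_topology}) \<Rightarrow> bool" where
  "square_integrable M u \<longleftrightarrow> u \<in> borel_measurable M \<and> integrable M (\<lambda>x. (norm (u x))\<^sup>2)"

lemma square_integrable_measurable [measurable_dest]:
  "square_integrable M u \<Longrightarrow> u \<in> borel_measurable M"
  by (simp add: square_integrable_def)

lemma square_integrable_integrable:
  "square_integrable M u \<Longrightarrow> integrable M (\<lambda>x. (norm (u x))\<^sup>2)"
  by (simp add: square_integrable_def)

lemma integrable_mult_square_integrable:
  assumes u: "square_integrable M u" and v: "square_integrable M v"
  shows "integrable M (\<lambda>x. u x * v x)"
proof (rule Bochner_Integration.integrable_bound)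
  show "integrable M (\<lambda>x. (norm (u x))\<^sup>2 + (norm (v x))\<^sup>2)"
    using u v by (simp add: square_integrable_def)
  show "(\<lambda>x. u x * v x) \<in> borel_measurable M"
    using u v by measurable
  have "norm (a * b) \<le> norm ((norm a)\<^sup>2 + (norm b)\<^sup>2)" for a b :: 'b
  proof -
    have "2 * (norm a * norm b) \<le> (norm a)\<^sup>2 + (norm b)\<^sup>2"
      using sum_squares_bound[of "norm a" "norm b"] by (simp add: ac_simps)
    moreover have "0 \<le> norm a * norm b" by simp
    ultimately show ?thesis
      unfolding norm_mult real_norm_def by linarith
  qed
  then show "AE x in M. norm (u x * v x) \<le> norm ((norm (u x))\<^sup>2 + (norm (v x))\<^sup>2)"
    by simp
qed

lemma norm_add_square_le: "(norm (a + b))\<^sup>2 \<le> 2 * (norm a)\<^sup>2 + 2 * (norm b)\<^sup>2"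
proof -
  have "(norm (a + b))\<^sup>2 \<le> (norm a + norm b)\<^sup>2"
    by (intro power_mono norm_triangle_ineq) simp
  also have "\<dots> \<le> 2 * (norm a)\<^sup>2 + 2 * (norm b)\<^sup>2"
    using sum_squares_bound[of "norm a" "norm b"] by (simp add: power2_sum)
  finally show ?thesis .
qed

lemma square_integrable_cmult:
  assumes "square_integrable M u" shows "square_integrable M (\<lambda>x. c * u x)"
  using assms by (auto simp: square_integrable_def norm_mult power_mult_distrib)

lemma square_integrable_add:
  assumes u: "square_integrable M u" and v: "square_integrable M v"
  shows "square_integrable M (\<lambda>x. u x + v x)"
  unfolding square_integrable_def
proof
  show "(\<lambda>x. u x + v x) \<in> borel_measurable M"
    using u v by measurable
  show "integrable M (\<lambda>x. (norm (u x + v x))\<^sup>2)"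
  proof (rule Bochner_Integration.integrable_bound)
    show "integrable M (\<lambda>x. 2 * (norm (u x))\<^sup>2 + 2 * (norm (v x))\<^sup>2)"
      using u v by (simp add: square_integrable_def)
    show "(\<lambda>x. (norm (u x + v x))\<^sup>2) \<in> borel_measurable M"
      using u v by measurable
    show "AE x in M. norm ((norm (u x + v x))\<^sup>2) \<le> norm (2 * (norm (u x))\<^sup>2 + 2 * (norm (v x))\<^sup>2)"
      by (simp add: norm_add_square_le)
  qed
qed

lemma square_integrable_diff:
  assumes "square_integrable M u" and "square_integrable M v"
  shows "square_integrable M (\<lambda>x. u x - v x)"
  using square_integrable_add[OF assms(1) square_integrable_cmult[OF assms(2), of "-1"]] by simp

lemma square_integrable_norm:
  "square_integrable M u \<Longrightarrow> square_integrable M (\<lambda>x. norm (u x))"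
  by (auto simp: square_integrable_def)

lemma borel_measurable_cnj [measurable (raw)]:
  "f \<in> borel_measurable M \<Longrightarrow> (\<lambda>x. cnj (f x)) \<in> borel_measurable M"
  by (rule borel_measurable_continuous_on[OF continuous_on_cnj[OF continuous_on_id]])

lemma square_integrable_cnj:
  "square_integrable M u \<Longrightarrow> square_integrable M (\<lambda>x. cnj (u x))"
  by (auto simp: square_integrable_def intro: borel_measurable_cnj)

lemma square_integrable_sum:
  "(\<And>i. i \<in> I \<Longrightarrow> square_integrable M (u i)) \<Longrightarrow> square_integrable M (\<lambda>x. \<Sum>i\<in>I. u i x)"
proof (induction I rule: infinite_finite_induct)
  case (insert i I)
  then show ?case by (simp add: square_integrable_add)
qed (simp_all add: square_integrable_def)

text \<open>
  For every real \<open>s\<close> the integral of \<open>(s |u| - |v|)\<^sup>2\<close> is a nonnegative quadratic polynomial in \<open>s\<close>;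
  nonpositivity of its discriminant is the claim.
\<close>

lemma Cauchy_Schwarz_integral:
  assumes u: "square_integrable M u" and v: "square_integrable M v"
  shows "(norm (LINT x|M. u x * v x))\<^sup>2 \<le> (LINT x|M. (norm (u x))\<^sup>2) * (LINT x|M. (norm (v x))\<^sup>2)"
proof -
  define A B C where "A = (LINT x|M. (norm (u x))\<^sup>2)" and "B = (LINT x|M. (norm (v x))\<^sup>2)"
    and "C = (LINT x|M. norm (u x) * norm (v x))"
  have uv: "integrable M (\<lambda>x. norm (u x) * norm (v x))"
    using integrable_mult_square_integrable[OF square_integrable_norm[OF u] square_integrable_norm[OF v]] .
  note int = square_integrable_integrable[OF u] square_integrable_integrable[OF v] uv
  have C: "norm (LINT x|M. u x * v x) \<le> C"
    unfolding C_def using integral_norm_bound[of M "\<lambda>x. u x * v x"] by (simp add: norm_mult)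
  have "C \<ge> 0" "A \<ge> 0" "B \<ge> 0" by (auto simp: A_def B_def C_def)
  have q: "0 \<le> s\<^sup>2 * A - 2 * s * C + B" for s
  proof -
    have "0 \<le> (LINT x|M. (s * norm (u x) - norm (v x))\<^sup>2)" by simp
    also have "(\<lambda>x. (s * norm (u x) - norm (v x))\<^sup>2) =
      (\<lambda>x. s\<^sup>2 * (norm (u x))\<^sup>2 - 2 * s * (norm (u x) * norm (v x)) + (norm (v x))\<^sup>2)"
      by (simp add: power2_diff power_mult_distrib algebra_simps)
    also have "(LINT x|M. \<dots> x) = s\<^sup>2 * A - 2 * s * C + B"
      using int by (simp add: A_def B_def C_def del: mult_cancel_left)
    finally show ?thesis .
  qed
  have "C\<^sup>2 \<le> A * B"
  proof (cases "A = 0")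
    case True
    then have "C * C \<le> 0"
      \<comment> \<open>the polynomial has degree one here, and this \<open>s\<close> would give it the value -1 if \<open>C\<close> were nonzero\<close>
      using q[of "(B + 1) / (2 * C)"] by (cases "C = 0") auto
    then show ?thesis using True by (simp add: power2_eq_square)
  next
    case False
    then have "A > 0" using \<open>A \<ge> 0\<close> by simp
    then show ?thesis using q[of "C / A"]
      by (simp add: field_simps power2_eq_square)
  qed
  then show ?thesis
    using power_mono[OF C norm_ge_zero, of 2] by (simp add: A_def B_def)
qed

definition L2_tendsto :: "'a measure \<Rightarrow> (nat \<Rightarrow> 'a \<Rightarrow> 'b::{banach,real_normed_field,second_countable_topology}) \<Rightarrow> ('a \<Rightarrow> 'b) \<Rightarrow> bool" where
  "L2_tendsto M u v \<longleftrightarrow> (\<forall>n. square_integrable M (u n)) \<and> square_integrable M v \<and>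
     (\<lambda>n. LINT x|M. (norm (u n x - v x))\<^sup>2) \<longlonglongrightarrow> 0"

lemma L2_tendsto_integral_mult:
  assumes u: "L2_tendsto M u v" and w: "square_integrable M w"
  shows "(\<lambda>n. LINT x|M. u n x * w x) \<longlonglongrightarrow> (LINT x|M. v x * w x)"
proof -
  have si: "square_integrable M (u n)" "square_integrable M v" for n
    using u by (auto simp: L2_tendsto_def)
  have eq: "(LINT x|M. u n x * w x) - (LINT x|M. v x * w x) = (LINT x|M. (u n x - v x) * w x)" for n
    using si w by (simp add: integrable_mult_square_integrable left_diff_distrib)
  have "(\<lambda>n. (LINT x|M. (norm (u n x - v x))\<^sup>2) * (LINT x|M. (norm (w x))\<^sup>2)) \<longlonglongrightarrow> 0"
    using u by (auto simp: L2_tendsto_def intro: tendsto_mult_left_zero)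
  then have "(\<lambda>n. (norm ((LINT x|M. u n x * w x) - (LINT x|M. v x * w x)))\<^sup>2) \<longlonglongrightarrow> 0"
    unfolding eq
    by (rule Lim_null_comparison[rotated])
       (auto intro!: always_eventually Cauchy_Schwarz_integral square_integrable_diff si w)
  then have "(\<lambda>n. sqrt ((norm ((LINT x|M. u n x * w x) - (LINT x|M. v x * w x)))\<^sup>2)) \<longlonglongrightarrow> sqrt 0"
    by (rule tendsto_real_sqrt)
  then show ?thesis
    by (simp add: tendsto_norm_zero_iff LIM_zero_iff)
qed

text \<open>
  Since \<open>||a|\<^sup>2 - |b|\<^sup>2| \<le> 2 |a - b| |b| + |a - b|\<^sup>2\<close>, the Cauchy-Schwarz inequality bounds the difference
  of the two integrals in terms of \<open>\<integral> |u\<^sub>n - v|\<^sup>2\<close>.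
\<close>

lemma L2_tendsto_norm:
  assumes u: "L2_tendsto M u v"
  shows "(\<lambda>n. LINT x|M. (norm (u n x))\<^sup>2) \<longlonglongrightarrow> (LINT x|M. (norm (v x))\<^sup>2)"
proof (rule LIM_zero_cancel)
  have si: "square_integrable M (u n)" "square_integrable M v" for n
    using u by (auto simp: L2_tendsto_def)
  define d where "d n x = u n x - v x" for n x
  have sd: "square_integrable M (d n)" for n
    unfolding d_def by (intro square_integrable_diff si)
  define D where "D n = (LINT x|M. (norm (d n x))\<^sup>2)" for n
  define B where "B = (LINT x|M. (norm (v x))\<^sup>2)"
  have D: "D \<longlonglongrightarrow> 0" using u unfolding D_def d_def by (simp add: L2_tendsto_def)
  have B0: "B \<ge> 0" "D n \<ge> 0" for n by (auto simp: B_def D_def)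
  have "\<bar>(LINT x|M. (norm (u n x))\<^sup>2) - B\<bar> \<le> 2 * sqrt (D n * B) + D n" for n
  proof -
    have pw: "\<bar>(norm a)\<^sup>2 - (norm b)\<^sup>2\<bar> \<le> 2 * (norm (a - b) * norm b) + (norm (a - b))\<^sup>2" for a b :: 'b
    proof -
      have "\<bar>norm a - norm b\<bar> \<le> norm (a - b)" by (rule norm_triangle_ineq3)
      moreover have "(norm a)\<^sup>2 - (norm b)\<^sup>2 = (norm a - norm b) * (2 * norm b + (norm a - norm b))"
        by (simp add: algebra_simps power2_eq_square)
      then have "\<bar>(norm a)\<^sup>2 - (norm b)\<^sup>2\<bar> \<le> \<bar>norm a - norm b\<bar> * (2 * norm b + \<bar>norm a - norm b\<bar>)"
        by (simp add: abs_mult mult_left_mono)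
      moreover have "\<bar>norm a - norm b\<bar> * (2 * norm b + \<bar>norm a - norm b\<bar>) \<le> norm (a - b) * (2 * norm b + norm (a - b))"
        by (intro mult_mono add_left_mono calculation(1)) auto
      ultimately show ?thesis by (simp add: algebra_simps power2_eq_square)
    qed
    have i1: "integrable M (\<lambda>x. norm (d n x) * norm (v x))"
      using integrable_mult_square_integrable[OF square_integrable_norm[OF sd] square_integrable_norm[OF si(2)]] .
    have "(LINT x|M. (norm (u n x))\<^sup>2) - B = (LINT x|M. (norm (u n x))\<^sup>2 - (norm (v x))\<^sup>2)"
      using si by (simp add: B_def square_integrable_integrable)
    also have "\<bar>\<dots>\<bar> \<le> (LINT x|M. 2 * (norm (d n x) * norm (v x)) + (norm (d n x))\<^sup>2)"
    proof (rule order_trans[OF integral_abs_bound integral_mono])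
      show "integrable M (\<lambda>x. \<bar>(norm (u n x))\<^sup>2 - (norm (v x))\<^sup>2\<bar>)"
        using si by (simp add: square_integrable_integrable)
      show "integrable M (\<lambda>x. 2 * (norm (d n x) * norm (v x)) + (norm (d n x))\<^sup>2)"
        by (intro Bochner_Integration.integrable_add integrable_mult_right i1 square_integrable_integrable sd)
    qed (simp add: d_def pw)
    also have "\<dots> = 2 * (LINT x|M. norm (d n x) * norm (v x)) + D n"
      using i1 sd by (simp add: square_integrable_integrable D_def)
    also have "(LINT x|M. norm (d n x) * norm (v x)) \<le> sqrt (D n * B)"
      using Cauchy_Schwarz_integral[OF square_integrable_norm[OF sd[of n]] square_integrable_norm[OF si(2)]]
      by (intro real_le_rsqrt) (simp add: D_def B_def)
    finally show ?thesis by simp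
  qed
  moreover have "(\<lambda>n. 2 * sqrt (D n * B) + D n) \<longlonglongrightarrow> 2 * sqrt (0 * B) + 0"
    by (intro tendsto_intros D)
  then have g: "(\<lambda>n. 2 * sqrt (D n * B) + D n) \<longlonglongrightarrow> 0" by simp
  ultimately show "(\<lambda>n. (LINT x|M. (norm (u n x))\<^sup>2) - B) \<longlonglongrightarrow> 0"
    by (intro Lim_null_comparison[OF _ g] always_eventually) simp
qed

lemma L2_tendsto_add:
  assumes u: "L2_tendsto M u v" and u': "L2_tendsto M u' v'"
  shows "L2_tendsto M (\<lambda>n x. u n x + u' n x) (\<lambda>x. v x + v' x)"
proof -
  have si: "square_integrable M (u n)" "square_integrable M v"
    "square_integrable M (u' n)" "square_integrable M v'" for n
    using u u' by (auto simp: L2_tendsto_def)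
  have "norm (LINT x|M. (norm (u n x + u' n x - (v x + v' x)))\<^sup>2) \<le>
      2 * (LINT x|M. (norm (u n x - v x))\<^sup>2) + 2 * (LINT x|M. (norm (u' n x - v' x))\<^sup>2)" for n
  proof -
    note i = square_integrable_integrable[OF square_integrable_diff]
    have "norm (LINT x|M. (norm (u n x + u' n x - (v x + v' x)))\<^sup>2)
      = (LINT x|M. (norm (u n x + u' n x - (v x + v' x)))\<^sup>2)" by simp
    also have "\<dots> \<le> (LINT x|M. 2 * (norm (u n x - v x))\<^sup>2 + 2 * (norm (u' n x - v' x))\<^sup>2)"
    proof (rule integral_mono)
      fix x show "(norm (u n x + u' n x - (v x + v' x)))\<^sup>2 \<le> 2 * (norm (u n x - v x))\<^sup>2 + 2 * (norm (u' n x - v' x))\<^sup>2"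
        using norm_add_square_le[of "u n x - v x" "u' n x - v' x"] by (simp add: algebra_simps)
    qed (intro i Bochner_Integration.integrable_add integrable_mult_right square_integrable_add square_integrable_diff si)+
    also have "\<dots> = 2 * (LINT x|M. (norm (u n x - v x))\<^sup>2) + 2 * (LINT x|M. (norm (u' n x - v' x))\<^sup>2)"
      using si by (simp add: i)
    finally show ?thesis .
  qed
  note bound = this
  have "(\<lambda>n. 2 * (LINT x|M. (norm (u n x - v x))\<^sup>2) + 2 * (LINT x|M. (norm (u' n x - v' x))\<^sup>2)) \<longlonglongrightarrow> 2 * 0 + 2 * 0"
    using u u' by (intro tendsto_intros) (auto simp: L2_tendsto_def)
  then have g: "(\<lambda>n. 2 * (LINT x|M. (norm (u n x - v x))\<^sup>2) + 2 * (LINT x|M. (norm (u' n x - v' x))\<^sup>2)) \<longlonglongrightarrow> 0"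
    by simp
  show ?thesis
    unfolding L2_tendsto_def
  proof (intro conjI allI)
    show "(\<lambda>n. LINT x|M. (norm (u n x + u' n x - (v x + v' x)))\<^sup>2) \<longlonglongrightarrow> 0"
      by (rule Lim_null_comparison[OF always_eventually g]) (use bound in blast)
  qed (intro square_integrable_add si)+
qed

lemma L2_tendsto_cmult:
  assumes "L2_tendsto M u v" shows "L2_tendsto M (\<lambda>n x. c * u n x) (\<lambda>x. c * v x)"
proof -
  have "(\<lambda>n. (norm c)\<^sup>2 * (LINT x|M. (norm (u n x - v x))\<^sup>2)) \<longlonglongrightarrow> (norm c)\<^sup>2 * 0"
    using assms by (intro tendsto_mult_left) (simp add: L2_tendsto_def)
  moreover have "(norm c)\<^sup>2 * (LINT x|M. (norm (u n x - v x))\<^sup>2) = (LINT x|M. (norm (c * u n x - c * v x))\<^sup>2)" for n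
    by (simp add: norm_mult power_mult_distrib flip: right_diff_distrib)
  ultimately show ?thesis
    using assms by (simp add: L2_tendsto_def square_integrable_cmult)
qed

lemma L2_tendsto_isometry:
  assumes "L2_tendsto M u v"
    and "\<And>n. square_integrable M (u' n)" "square_integrable M v'"
    and "\<And>n. (LINT x|M. (norm (u' n x - v' x))\<^sup>2) = (LINT x|M. (norm (u n x - v x))\<^sup>2)"
  shows "L2_tendsto M u' v'"
  using assms by (simp add: L2_tendsto_def)

section \<open>Plancherel's identity for tame functions\<close>

lemma borel_measurable_cis [measurable]: "cis \<in> borel_measurable borel"
  by (intro borel_measurable_continuous_onI continuous_intros)

text \<open>
  The Gaussian is its own Fourier transform, up to the factor \<open>sqrt (2\<pi>)\<close>: this is the characteristic
  function of the standard normal distribution.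
\<close>

lemma integral_gaussian_cis:
  "(LINT v|lborel. complex_of_real (exp (- (v\<^sup>2 / 2))) * cis (t * v)) = of_real (sqrt (2 * pi) * exp (- (t\<^sup>2 / 2)))"
proof -
  have "complex_of_real (exp (- (t\<^sup>2 / 2))) = (LINT v|std_normal_distribution. iexp (t * v))"
    using fun_cong[OF char_std_normal_distribution, of t] by (simp add: char_def)
  also have "\<dots> = (LINT v|lborel. std_normal_density v *\<^sub>R iexp (t * v))"
    by (subst integral_density) (auto simp: normal_density_nonneg)
  also have "(\<lambda>v. std_normal_density v *\<^sub>R iexp (t * v)) =
      (\<lambda>v. of_real (1 / sqrt (2 * pi)) * (complex_of_real (exp (- (v\<^sup>2 / 2))) * cis (t * v)))"
    by (auto simp: std_normal_density_def scaleR_conv_of_real cis_conv_exp)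
  also have "(LINT v|lborel. \<dots> v) = of_real (1 / sqrt (2 * pi)) * (LINT v|lborel. complex_of_real (exp (- (v\<^sup>2 / 2))) * cis (t * v))"
    by (rule integral_mult_right_zero)
  finally show ?thesis
    by (simp add: field_simps)
qed

lemma integrable_gaussian: "integrable lborel (\<lambda>v::real. exp (- (v\<^sup>2 / 2)))"
proof -
  have "integrable lborel (\<lambda>v. sqrt (2 * pi) * std_normal_density v)"
    by (intro integrable_mult_right integrable_normal_density) simp
  then show ?thesis by (simp add: std_normal_density_def)
qed

lemma integrable_gaussian_scaled: "a > 0 \<Longrightarrow> integrable lborel (\<lambda>v::real. exp (- ((a * v)\<^sup>2 / 2)))"
  using lborel_integrable_real_affine[OF integrable_gaussian, of a 0] by simp

lemma integral_gaussian: "(LINT v|lborel. exp (- (v\<^sup>2 / 2))) = sqrt (2 * pi)"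
proof -
  have "complex_of_real (LINT v|lborel. exp (- (v\<^sup>2 / 2))) = of_real (sqrt (2 * pi))"
    using integral_gaussian_cis[of 0] by (simp flip: integral_complex_of_real)
  then show ?thesis using of_real_eq_iff by blast
qed

lemma integral_gaussian_cis_scaled:
  assumes "a > 0"
  shows "(LINT w|lborel. complex_of_real (exp (- ((a * w)\<^sup>2 / 2))) * cis (w * s)) =
    of_real (sqrt (2 * pi) / a * exp (- ((s / a)\<^sup>2 / 2)))"
proof -
  have "(LINT w|lborel. complex_of_real (exp (- ((a * w)\<^sup>2 / 2))) * cis (w * s)) =
     \<bar>1 / a\<bar> *\<^sub>R (LINT v|lborel. complex_of_real (exp (- (v\<^sup>2 / 2))) * cis (s / a * v))"
    using assms
    by (subst lborel_integral_real_affine[where c = "1 / a" and t = 0])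
       (auto simp: field_simps)
  then show ?thesis
    unfolding integral_gaussian_cis using assms by (simp add: scaleR_conv_of_real)
qed

text \<open>
  Domination by a product makes the integrability hypothesis of Fubini's theorem automatic. All kernels
  below are products of an integrable function of each variable with a unimodular factor.
\<close>

lemma Fubini_product_bound:
  fixes K :: "real \<Rightarrow> real \<Rightarrow> complex" and \<phi> \<psi> :: "real \<Rightarrow> real"
  assumes [measurable]: "(\<lambda>(x, y). K x y) \<in> borel_measurable (borel \<Otimes>\<^sub>M borel)"
    and \<phi>: "integrable lborel \<phi>" and \<psi>: "integrable lborel \<psi>"
    and bound: "\<And>x y. norm (K x y) \<le> \<phi> x * \<psi> y"
  shows "(LINT x|lborel. LINT y|lborel. K x y) = (LINT y|lborel. LINT x|lborel. K x y)"
proof -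
  have m: "(\<lambda>(x, y). K x y) \<in> borel_measurable (lborel \<Otimes>\<^sub>M lborel)"
    using assms(1) by simp
  have i: "integrable lborel (\<lambda>y. K x y)" for x
    by (rule Bochner_Integration.integrable_bound[where f = "\<lambda>y. \<phi> x * \<psi> y"])
       (use \<psi> bound in \<open>auto intro: order_trans[OF _ abs_ge_self]\<close>)
  have "integrable (lborel \<Otimes>\<^sub>M lborel) (\<lambda>(x, y). K x y)"
  proof (rule lborel_pair.Fubini_integrable[OF m])
    show "integrable lborel (\<lambda>x. LINT y|lborel. norm (case (x, y) of (x, y) \<Rightarrow> K x y))"
    proof (rule Bochner_Integration.integrable_bound)
      show "integrable lborel (\<lambda>x. \<phi> x * (LINT y|lborel. \<psi> y))" using \<phi> by simp
      show "(\<lambda>x. LINT y|lborel. norm (case (x, y) of (x, y) \<Rightarrow> K x y)) \<in> borel_measurable lborel"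
        by measurable
      have "norm (LINT y|lborel. norm (K x y)) \<le> norm (\<phi> x * (LINT y|lborel. \<psi> y))" for x
      proof -
        have "(LINT y|lborel. norm (K x y)) \<le> (LINT y|lborel. \<phi> x * \<psi> y)"
          by (intro integral_mono integrable_norm i integrable_mult_right \<psi> bound)
        moreover have "0 \<le> (LINT y|lborel. norm (K x y))" by simp
        ultimately show ?thesis by simp
      qed
      then show "AE x in lborel. norm (LINT y|lborel. norm (case (x, y) of (x, y) \<Rightarrow> K x y)) \<le> norm (\<phi> x * (LINT y|lborel. \<psi> y))"
        by simp
    qed
    show "AE x in lborel. integrable lborel (\<lambda>y. case (x, y) of (x, y) \<Rightarrow> K x y)"
      using i by simp
  qed
  from lborel_pair.Fubini_integral[OF this] show ?thesis by simp
qed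

text \<open>
  A class of test functions that contains the truncations of continuous functions and the indicator
  functions of bounded intervals, and is closed under sums and under \<open>x \<mapsto> u - x\<close>. Boundedness and
  bounded support give integrability and dominating functions; the finite set of discontinuities is a
  null set, which is what pointwise convergence of Gaussian averages requires.
\<close>

definition tame :: "(real \<Rightarrow> real) \<Rightarrow> bool" where
  "tame h \<longleftrightarrow> h \<in> borel_measurable borel \<and> finite {x. \<not> isCont h x} \<and>
     (\<exists>R M. \<forall>x. \<bar>h x\<bar> \<le> M * indicator {-R..R} x)"

text \<open>
  The kernel is written with \<open>cis\<close>, whose modulus is one by simplification;
  \<open>truncated_fourier_eq\<close> links this to the exponential kernel.
\<close>

definition fourier :: "(real \<Rightarrow> real) \<Rightarrow> real \<Rightarrow> complex" where
  "fourier h \<omega> = (LINT x|lborel. of_real (h x) * cis (- (\<omega> * x)))"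

lemma tame_measurable [measurable_dest]: "tame h \<Longrightarrow> h \<in> borel_measurable borel"
  by (simp add: tame_def)

lemma tame_boundedE:
  assumes "tame h" obtains C where "\<And>x. \<bar>h x\<bar> \<le> C" "C \<ge> 0"
proof -
  from assms obtain R M where h: "\<And>x. \<bar>h x\<bar> \<le> M * indicator {-R..R} x"
    by (auto simp: tame_def)
  have "\<bar>h x\<bar> \<le> \<bar>M\<bar>" for x
    using h[of x] by (cases "x \<in> {-R..R}") auto
  then show ?thesis using that by force
qed

lemma tame_integrable: assumes "tame h" shows "integrable lborel h"
proof -
  from assms obtain R M where h: "\<And>x. \<bar>h x\<bar> \<le> M * indicator {-R..R} x"
    by (auto simp: tame_def)
  show ?thesis
    by (rule Bochner_Integration.integrable_bound[where f = "\<lambda>x. M * indicator {-R..R} x"])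
       (use assms h in \<open>auto simp: emeasure_lborel_Icc_eq intro!: integrable_real_indicator intro: order_trans[OF h abs_ge_self]\<close>)
qed

lemma tame_AE_isCont: "tame h \<Longrightarrow> AE x in lborel. isCont h x"
  by (rule AE_I'[where N = "{x. \<not> isCont h x}"])
     (auto simp: tame_def intro: finite_imp_null_set_lborel)

lemma tame_mult_bounded:
  fixes k :: "real \<Rightarrow> real"
  assumes "tame h" and that: "k \<in> borel_measurable borel" "\<And>x. \<bar>k x\<bar> \<le> C"
  shows "integrable lborel (\<lambda>x. h x * k x)"
proof (rule Bochner_Integration.integrable_bound[where f = "\<lambda>x. C * \<bar>h x\<bar>"])
  show "integrable lborel (\<lambda>x. C * \<bar>h x\<bar>)" using tame_integrable[OF assms(1)] by simp
  show "AE x in lborel. norm (h x * k x) \<le> norm (C * \<bar>h x\<bar>)"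
  proof (intro AE_I2)
    fix x have "\<bar>h x\<bar> * \<bar>k x\<bar> \<le> \<bar>h x\<bar> * \<bar>C\<bar>" using that(2)[of x] by (intro mult_left_mono) auto
    then show "norm (h x * k x) \<le> norm (C * \<bar>h x\<bar>)" by (simp add: abs_mult ac_simps)
  qed
qed (use assms that in measurable)

lemma tame_square_integrable:
  assumes h: "tame h" shows "square_integrable lborel h"
proof -
  obtain C where "\<And>x. \<bar>h x\<bar> \<le> C" "C \<ge> 0" using tame_boundedE[OF h] by blast
  then show ?thesis
    using tame_mult_bounded[OF h tame_measurable[OF h]] tame_measurable[OF h]
    by (auto simp: square_integrable_def power2_eq_square)
qed

lemma integrable_mult_cis:
  "integrable lborel h \<Longrightarrow> integrable lborel (\<lambda>x. complex_of_real (h x) * cis (s * x))"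
  by (rule Bochner_Integration.integrable_bound[of _ h]) (auto simp: norm_mult)

lemma fourier_bound: "norm (fourier h \<omega>) \<le> (LINT x|lborel. \<bar>h x\<bar>)"
  unfolding fourier_def
  using integral_norm_bound[of lborel "\<lambda>x. complex_of_real (h x) * cis (- (\<omega> * x))"]
  by (simp add: norm_mult)

text \<open>
  Dominated convergence with \<open>|h|\<close> as dominating function. This continuity is what later lets
  Weierstrass' theorem apply to transforms.
\<close>

lemma continuous_on_fourier:
  assumes "integrable lborel h"
  shows "continuous_on UNIV (fourier h)"
  unfolding continuous_on_eq_continuous_at[OF open_UNIV]
proof (intro ballI continuous_at_sequentiallyI)
  fix \<omega> X assume X: "X \<longlonglongrightarrow> (\<omega>::real)"
  show "(\<lambda>n. fourier h (X n)) \<longlonglongrightarrow> fourier h \<omega>"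
    unfolding fourier_def
  proof (rule integral_dominated_convergence[where w = "\<lambda>x. \<bar>h x\<bar>"])
    show "AE x in lborel. (\<lambda>n. complex_of_real (h x) * cis (- (X n * x))) \<longlonglongrightarrow> complex_of_real (h x) * cis (- (\<omega> * x))"
      by (intro AE_I2 tendsto_intros X)
  qed (use assms in \<open>auto simp: norm_mult\<close>)
qed

lemma borel_measurable_fourier: "integrable lborel h \<Longrightarrow> fourier h \<in> borel_measurable borel"
  by (intro borel_measurable_continuous_onI continuous_on_fourier)

lemma cnj_fourier: "cnj (fourier h \<omega>) = (LINT x|lborel. of_real (h x) * cis (\<omega> * x))"
  unfolding fourier_def by (subst Bochner_Integration.integral_cnj[symmetric]) (simp add: cis_cnj)

text \<open>
  With the Gaussian factor the double integral converges absolutely. Integrating over \<open>\<omega>\<close> first gives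
  a Gaussian of width \<open>a\<close> centred at \<open>t\<close>, and \<open>x = t + a z\<close> rescales it to unit width.
\<close>

lemma fourier_gaussian_inversion:
  assumes h: "tame h" and a: "a > 0"
  shows "(LINT \<omega>|lborel. fourier h \<omega> * of_real (exp (- ((a * \<omega>)\<^sup>2 / 2))) * cis (\<omega> * t)) =
     of_real (sqrt (2 * pi) * (LINT z|lborel. h (t + a * z) * exp (- (z\<^sup>2 / 2))))"
proof -
  note [measurable] = tame_measurable[OF h]
  define K where "K \<omega> x = complex_of_real (h x) * cis (- (\<omega> * x)) * (of_real (exp (- ((a * \<omega>)\<^sup>2 / 2))) * cis (\<omega> * t))" for \<omega> x
  have "(LINT \<omega>|lborel. fourier h \<omega> * of_real (exp (- ((a * \<omega>)\<^sup>2 / 2))) * cis (\<omega> * t)) =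
      (LINT \<omega>|lborel. LINT x|lborel. K \<omega> x)"
    by (simp add: fourier_def K_def mult.assoc flip: integral_mult_left_zero)
  also have "\<dots> = (LINT x|lborel. LINT \<omega>|lborel. K \<omega> x)"
  proof (rule Fubini_product_bound)
    show "(\<lambda>(x, y). K x y) \<in> borel_measurable (borel \<Otimes>\<^sub>M borel)"
      unfolding K_def by measurable
    show "integrable lborel (\<lambda>w. exp (- ((a * w)\<^sup>2 / 2)))"
      by (rule integrable_gaussian_scaled[OF a])
    show "integrable lborel (\<lambda>x. \<bar>h x\<bar>)" using tame_integrable[OF h] by simp
    show "norm (K x y) \<le> exp (- ((a * x)\<^sup>2 / 2)) * \<bar>h y\<bar>" for x y
      by (simp add: K_def norm_mult)
  qed
  also have "\<dots> = (LINT x|lborel. of_real (h x) * of_real (sqrt (2 * pi) / a * exp (- (((t - x) / a)\<^sup>2 / 2))))"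
  proof (rule Bochner_Integration.integral_cong[OF refl])
    fix x
    have "K \<omega> x = of_real (h x) * (of_real (exp (- ((a * \<omega>)\<^sup>2 / 2))) * cis (\<omega> * (t - x)))" for \<omega>
      unfolding K_def by (simp add: algebra_simps flip: cis_divide cis_mult)
        (simp add: cis_divide cis_mult field_simps)
    then show "(LINT \<omega>|lborel. K \<omega> x) = of_real (h x) * of_real (sqrt (2 * pi) / a * exp (- (((t - x) / a)\<^sup>2 / 2)))"
      by (simp add: integral_gaussian_cis_scaled[OF a])
  qed
  also have "\<dots> = of_real (LINT x|lborel. h x * (sqrt (2 * pi) / a * exp (- (((t - x) / a)\<^sup>2 / 2))))"
    by (simp flip: integral_complex_of_real of_real_mult)
  also have "(LINT x|lborel. h x * (sqrt (2 * pi) / a * exp (- (((t - x) / a)\<^sup>2 / 2)))) =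
     (LINT z|lborel. sqrt (2 * pi) * (h (t + a * z) * exp (- (z\<^sup>2 / 2))))"
    using a by (subst lborel_integral_real_affine[where c = a and t = t])
      (auto intro!: Bochner_Integration.integral_cong simp: mult.left_commute simp flip: integral_mult_right_zero integral_divide_zero)
  finally show ?thesis by simp
qed


text \<open>
  The conjugated transform of \<open>k\<close> is an integral over \<open>t\<close>; exchanging it with the integral over \<open>\<omega>\<close>
  leaves the regularized inversion formula for \<open>h\<close> inside.
\<close>

lemma fourier_gaussian_plancherel:
  assumes h: "tame h" and k: "tame k" and a: "a > 0"
  shows "(LINT \<omega>|lborel. fourier h \<omega> * cnj (fourier k \<omega>) * of_real (exp (- ((a * \<omega>)\<^sup>2 / 2)))) =
    of_real (sqrt (2 * pi) * (LINT t|lborel. k t * (LINT z|lborel. h (t + a * z) * exp (- (z\<^sup>2 / 2)))))"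
proof -
  note [measurable] = tame_measurable[OF h] tame_measurable[OF k] borel_measurable_fourier[OF tame_integrable[OF h]]
  define E where "E \<omega> = exp (- ((a * \<omega>)\<^sup>2 / 2))" for \<omega>
  have [measurable]: "E \<in> borel_measurable borel" unfolding E_def by measurable
  define C where "C = (LINT x|lborel. \<bar>h x\<bar>)"
  define K where "K \<omega> t = fourier h \<omega> * of_real (E \<omega>) * (of_real (k t) * cis (\<omega> * t))" for \<omega> t
  have "(LINT \<omega>|lborel. fourier h \<omega> * cnj (fourier k \<omega>) * of_real (E \<omega>)) = (LINT \<omega>|lborel. LINT t|lborel. K \<omega> t)"
    unfolding K_def cnj_fourier integral_mult_right_zero by (simp only: mult_ac)
  also have "\<dots> = (LINT t|lborel. LINT \<omega>|lborel. K \<omega> t)"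
  proof (rule Fubini_product_bound)
    show "(\<lambda>(x, y). K x y) \<in> borel_measurable (borel \<Otimes>\<^sub>M borel)"
      unfolding K_def by measurable
    show "integrable lborel (\<lambda>w. C * E w)"
      unfolding E_def by (intro integrable_mult_right integrable_gaussian_scaled[OF a])
    show "integrable lborel (\<lambda>x. \<bar>k x\<bar>)" using tame_integrable[OF k] by simp
    show "norm (K x y) \<le> C * E x * \<bar>k y\<bar>" for x y
      using fourier_bound[of h x] by (simp add: K_def norm_mult C_def E_def mult_right_mono)
  qed
  also have "\<dots> = (LINT t|lborel. of_real (k t) * (LINT \<omega>|lborel. fourier h \<omega> * of_real (E \<omega>) * cis (\<omega> * t)))"
    by (simp add: K_def mult.left_commute flip: integral_mult_right_zero)
  also have "\<dots> = (LINT t|lborel. of_real (sqrt (2 * pi) * (k t * (LINT z|lborel. h (t + a * z) * exp (- (z\<^sup>2 / 2))))))"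
    unfolding E_def fourier_gaussian_inversion[OF h a] by (simp add: ac_simps)
  also have "\<dots> = of_real (sqrt (2 * pi) * (LINT t|lborel. k t * (LINT z|lborel. h (t + a * z) * exp (- (z\<^sup>2 / 2)))))"
    unfolding integral_complex_of_real by simp
  finally show ?thesis by (simp add: E_def)
qed

text \<open>
  Two applications of dominated convergence: the inner integral is a Gaussian average of \<open>h\<close> around
  \<open>t\<close>, which tends to \<open>h(t)\<close> wherever \<open>h\<close> is continuous, that is almost everywhere; the outer one is
  dominated by a multiple of \<open>|k|\<close>.
\<close>

lemma gaussian_convolution_tendsto:
  fixes a :: "nat \<Rightarrow> real"
  assumes h: "tame h" and k: "tame k" and a: "a \<longlonglongrightarrow> 0"
  shows "(\<lambda>n. LINT t|lborel. k t * (LINT z|lborel. h (t + a n * z) * exp (- (z\<^sup>2 / 2)))) \<longlonglongrightarrow>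
    sqrt (2 * pi) * (LINT t|lborel. h t * k t)"
proof -
  note [measurable] = tame_measurable[OF h] tame_measurable[OF k]
  obtain C where C: "\<And>x. \<bar>h x\<bar> \<le> C" "C \<ge> 0" using tame_boundedE[OF h] by blast
  have int: "integrable lborel (\<lambda>z. h (t + b * z) * exp (- (z\<^sup>2 / 2)))" for t b
    by (rule Bochner_Integration.integrable_bound[where f = "\<lambda>z. C * exp (- (z\<^sup>2 / 2))"])
       (use C integrable_gaussian in \<open>auto simp: abs_mult mult_right_mono\<close>)
  have "(\<lambda>n. LINT t|lborel. k t * (LINT z|lborel. h (t + a n * z) * exp (- (z\<^sup>2 / 2)))) \<longlonglongrightarrow>
    (LINT t|lborel. k t * (h t * sqrt (2 * pi)))"
  proof (rule integral_dominated_convergence[where w = "\<lambda>t. \<bar>k t\<bar> * (C * sqrt (2 * pi))"])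
    show "integrable lborel (\<lambda>t. \<bar>k t\<bar> * (C * sqrt (2 * pi)))" using tame_integrable[OF k] by simp
    show "AE t in lborel. norm (k t * (LINT z|lborel. h (t + a n * z) * exp (- (z\<^sup>2 / 2)))) \<le> \<bar>k t\<bar> * (C * sqrt (2 * pi))" for n
    proof (intro AE_I2)
      fix t
      have "\<bar>LINT z|lborel. h (t + a n * z) * exp (- (z\<^sup>2 / 2))\<bar> \<le> (LINT z|lborel. C * exp (- (z\<^sup>2 / 2)))"
        by (rule order_trans[OF integral_abs_bound integral_mono])
           (use C integrable_abs[OF int[of t "a n"]] integrable_gaussian in \<open>auto simp: abs_mult mult_right_mono\<close>)
      then show "norm (k t * (LINT z|lborel. h (t + a n * z) * exp (- (z\<^sup>2 / 2)))) \<le> \<bar>k t\<bar> * (C * sqrt (2 * pi))"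
        by (simp add: abs_mult mult_left_mono integral_gaussian)
    qed
    show "AE t in lborel. (\<lambda>n. k t * (LINT z|lborel. h (t + a n * z) * exp (- (z\<^sup>2 / 2)))) \<longlonglongrightarrow> k t * (h t * sqrt (2 * pi))"
      using tame_AE_isCont[OF h]
    proof eventually_elim
      fix t assume t: "isCont h t"
      have "(\<lambda>n. LINT z|lborel. h (t + a n * z) * exp (- (z\<^sup>2 / 2))) \<longlonglongrightarrow> (LINT z|lborel. h t * exp (- (z\<^sup>2 / 2)))"
      proof (rule integral_dominated_convergence[where w = "\<lambda>z. C * exp (- (z\<^sup>2 / 2))"])
        show "AE z in lborel. (\<lambda>n. h (t + a n * z) * exp (- (z\<^sup>2 / 2))) \<longlonglongrightarrow> h t * exp (- (z\<^sup>2 / 2))"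
        proof (intro AE_I2 tendsto_intros isCont_tendsto_compose[OF t])
          fix z
          have "(\<lambda>n. t + a n * z) \<longlonglongrightarrow> t + 0 * z" by (intro tendsto_intros a)
          then show "(\<lambda>n. t + a n * z) \<longlonglongrightarrow> t" by simp
        qed
      qed (use C integrable_gaussian in \<open>auto simp: abs_mult mult_right_mono\<close>)
      then show "(\<lambda>n. k t * (LINT z|lborel. h (t + a n * z) * exp (- (z\<^sup>2 / 2)))) \<longlonglongrightarrow> k t * (h t * sqrt (2 * pi))"
        by (intro tendsto_intros) (simp add: integral_gaussian)
    qed
  qed measurable
  also have "(LINT t|lborel. k t * (h t * sqrt (2 * pi))) = sqrt (2 * pi) * (LINT t|lborel. h t * k t)"
    by (simp add: ac_simps flip: integral_mult_right_zero)
  finally show ?thesis .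
qed

lemma fourier_gaussian_plancherel_tendsto:
  assumes h: "tame h" and k: "tame k"
  shows "(\<lambda>n. LINT \<omega>|lborel. fourier h \<omega> * cnj (fourier k \<omega>) * of_real (exp (- ((\<omega> / real (Suc n))\<^sup>2 / 2)))) \<longlonglongrightarrow>
    of_real (2 * pi * (LINT t|lborel. h t * k t))"
proof -
  have "(\<lambda>n. sqrt (2 * pi) * (LINT t|lborel. k t * (LINT z|lborel. h (t + inverse (real (Suc n)) * z) * exp (- (z\<^sup>2 / 2))))) \<longlonglongrightarrow>
     sqrt (2 * pi) * (sqrt (2 * pi) * (LINT t|lborel. h t * k t))"
    by (intro tendsto_intros gaussian_convolution_tendsto[OF h k] LIMSEQ_inverse_real_of_nat)
  then have "(\<lambda>n. sqrt (2 * pi) * (LINT t|lborel. k t * (LINT z|lborel. h (t + inverse (real (Suc n)) * z) * exp (- (z\<^sup>2 / 2))))) \<longlonglongrightarrow>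
     2 * pi * (LINT t|lborel. h t * k t)"
    by (simp flip: mult.assoc)
  moreover have "(LINT \<omega>|lborel. fourier h \<omega> * cnj (fourier k \<omega>) * of_real (exp (- ((\<omega> / real (Suc n))\<^sup>2 / 2)))) =
      of_real (sqrt (2 * pi) * (LINT t|lborel. k t * (LINT z|lborel. h (t + inverse (real (Suc n)) * z) * exp (- (z\<^sup>2 / 2)))))" for n
  proof -
    have "\<omega> / real (Suc n) = inverse (real (Suc n)) * \<omega>" for \<omega>
      by (rule divide_inverse_commute)
    then show ?thesis
      using fourier_gaussian_plancherel[OF h k, of "inverse (real (Suc n))"] by (simp only:) simp
  qed
  ultimately show ?thesis
    by (simp only: tendsto_of_real_iff)
qed

lemma gaussian_dilation_tendsto: "(\<lambda>n. exp (- ((\<omega> / real (Suc n))\<^sup>2 / 2))) \<longlonglongrightarrow> 1"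
proof -
  have "isCont (\<lambda>s. exp (- ((\<omega> * s)\<^sup>2 / 2))) 0" by (intro continuous_intros) simp
  from isCont_tendsto_compose[OF this LIMSEQ_inverse_real_of_nat] show ?thesis
    by (simp add: divide_inverse[of \<omega>] del: of_nat_Suc)
qed

text \<open>
  By the regularized identity for \<open>h = k\<close>, the integrals of \<open>|h^|\<^sup>2\<close> against the Gaussian factors
  stay bounded; Fatou's lemma removes the factors. Integrability has to be known before the
  unregularized identity can be derived by dominated convergence.
\<close>

lemma square_integrable_fourier:
  assumes h: "tame h" shows "square_integrable lborel (fourier h)"
proof -
  note [measurable] = borel_measurable_fourier[OF tame_integrable[OF h]]
  define E where "E n \<omega> = exp (- ((\<omega> / real (Suc n))\<^sup>2 / 2))" for n \<omega>
  have [measurable]: "E n \<in> borel_measurable borel" for n unfolding E_def by measurable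
  have E_int: "integrable lborel (E n)" for n
    using integrable_gaussian_scaled[of "1 / real (Suc n)"] unfolding E_def by simp
  define C where "C = (LINT x|lborel. \<bar>h x\<bar>)"
  define J where "J n = (LINT \<omega>|lborel. (cmod (fourier h \<omega>))\<^sup>2 * E n \<omega>)" for n
  have Eint: "integrable lborel (\<lambda>\<omega>. (cmod (fourier h \<omega>))\<^sup>2 * E n \<omega>)" for n
  proof (rule Bochner_Integration.integrable_bound)
    show "integrable lborel (\<lambda>\<omega>. C\<^sup>2 * E n \<omega>)" using E_int by simp
    have "(cmod (fourier h \<omega>))\<^sup>2 \<le> C\<^sup>2" for \<omega>
      using fourier_bound[of h \<omega>] by (intro power_mono) (auto simp: C_def)
    then show "AE \<omega> in lborel. norm ((cmod (fourier h \<omega>))\<^sup>2 * E n \<omega>) \<le> norm (C\<^sup>2 * E n \<omega>)"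
      by (auto simp: E_def abs_mult mult_right_mono)
  qed measurable
  have "complex_of_real (J n) = (LINT \<omega>|lborel. fourier h \<omega> * cnj (fourier h \<omega>) * of_real (E n \<omega>))" for n
    unfolding J_def integral_complex_of_real[symmetric] by (simp add: complex_norm_square del: of_real_power)
  then have "(\<lambda>n. complex_of_real (J n)) \<longlonglongrightarrow> of_real (2 * pi * (LINT t|lborel. h t * h t))"
    using fourier_gaussian_plancherel_tendsto[OF h h] by (simp add: E_def)
  then have J: "J \<longlonglongrightarrow> 2 * pi * (LINT t|lborel. h t * h t)"
    by (simp only: tendsto_of_real_iff)
  have lim: "(\<lambda>n. ennreal ((cmod (fourier h \<omega>))\<^sup>2 * E n \<omega>)) \<longlonglongrightarrow> ennreal ((cmod (fourier h \<omega>))\<^sup>2)" for \<omega>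
    using tendsto_mult_left[OF gaussian_dilation_tendsto, of "(cmod (fourier h \<omega>))\<^sup>2" \<omega>]
    by (intro tendsto_ennrealI) (simp add: E_def)
  have "(\<integral>\<^sup>+ \<omega>. ennreal ((cmod (fourier h \<omega>))\<^sup>2) \<partial>lborel) =
     (\<integral>\<^sup>+ \<omega>. liminf (\<lambda>n. ennreal ((cmod (fourier h \<omega>))\<^sup>2 * E n \<omega>)) \<partial>lborel)"
    by (intro nn_integral_cong) (metis lim_imp_Liminf[OF _ lim] sequentially_bot)
  also have "\<dots> \<le> liminf (\<lambda>n. \<integral>\<^sup>+ \<omega>. ennreal ((cmod (fourier h \<omega>))\<^sup>2 * E n \<omega>) \<partial>lborel)"
    by (intro nn_integral_liminf) measurable
  also have "(\<lambda>n. \<integral>\<^sup>+ \<omega>. ennreal ((cmod (fourier h \<omega>))\<^sup>2 * E n \<omega>) \<partial>lborel) = (\<lambda>n. ennreal (J n))"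
    unfolding J_def by (intro ext nn_integral_eq_integral Eint) (auto simp: E_def)
  also have "liminf (\<lambda>n. ennreal (J n)) = ennreal (2 * pi * (LINT t|lborel. h t * h t))"
    by (intro lim_imp_Liminf tendsto_ennrealI J) simp
  also have "\<dots> < \<infinity>" by simp
  finally show ?thesis
    unfolding square_integrable_def by (auto intro!: integrableI_bounded)
qed

text \<open>
  The product of the two transforms is integrable, so the Gaussian factor can be removed by dominated
  convergence on the side of the transforms; uniqueness of limits gives the identity.
\<close>

lemma plancherel_tame:
  assumes h: "tame h" and k: "tame k"
  shows "(LINT \<omega>|lborel. fourier h \<omega> * cnj (fourier k \<omega>)) = of_real (2 * pi * (LINT t|lborel. h t * k t))"
proof (rule LIMSEQ_unique[OF _ fourier_gaussian_plancherel_tendsto[OF h k]])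
  note [measurable] = borel_measurable_fourier[OF tame_integrable[OF h]] borel_measurable_fourier[OF tame_integrable[OF k]]
  have "integrable lborel (\<lambda>\<omega>. cmod (fourier h \<omega>) * cmod (fourier k \<omega>))"
    by (intro integrable_mult_square_integrable square_integrable_norm square_integrable_fourier h k)
  then show "(\<lambda>n. LINT \<omega>|lborel. fourier h \<omega> * cnj (fourier k \<omega>) * of_real (exp (- ((\<omega> / real (Suc n))\<^sup>2 / 2)))) \<longlonglongrightarrow>
     (LINT \<omega>|lborel. fourier h \<omega> * cnj (fourier k \<omega>))"
  proof (rule integral_dominated_convergence[rotated 2])
    have "(\<lambda>n. fourier h \<omega> * cnj (fourier k \<omega>) * of_real (exp (- ((\<omega> / real (Suc n))\<^sup>2 / 2)))) \<longlonglongrightarrow>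
        fourier h \<omega> * cnj (fourier k \<omega>) * of_real 1" for \<omega>
      by (rule tendsto_mult_left[OF tendsto_of_real[OF gaussian_dilation_tendsto]])
    then show "AE \<omega> in lborel. (\<lambda>n. fourier h \<omega> * cnj (fourier k \<omega>) * of_real (exp (- ((\<omega> / real (Suc n))\<^sup>2 / 2)))) \<longlonglongrightarrow>
        fourier h \<omega> * cnj (fourier k \<omega>)"
      by simp
    show "AE \<omega> in lborel. norm (fourier h \<omega> * cnj (fourier k \<omega>) * of_real (exp (- ((\<omega> / real (Suc n))\<^sup>2 / 2)))) \<le>
       cmod (fourier h \<omega>) * cmod (fourier k \<omega>)" for n
      by (intro AE_I2) (simp add: norm_mult mult_left_le)
  qed measurable
qed

section \<open>Transforms of square integrable functions\<close>

lemma tame_cmult: "tame h \<Longrightarrow> tame (\<lambda>x. c * h x)"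
  unfolding tame_def
proof (elim conjE exE, intro conjI exI allI)
  fix R M x
  assume h: "\<forall>x. \<bar>h x\<bar> \<le> M * indicator {-R..R} x"
  then have "\<bar>c\<bar> * \<bar>h x\<bar> \<le> \<bar>c\<bar> * (M * indicator {-R..R} x)"
    by (intro mult_left_mono) auto
  then show "\<bar>c * h x\<bar> \<le> \<bar>c\<bar> * M * indicator {-R..R} x" by (simp add: abs_mult)
next
  assume "finite {x. \<not> isCont h x}"
  then show "finite {x. \<not> isCont (\<lambda>x. c * h x) x}"
    by (rule rev_finite_subset) (auto intro: continuous_intros)
qed measurable

lemma tame_add:
  assumes h: "tame h" and k: "tame k" shows "tame (\<lambda>x. h x + k x)"
proof -
  note [measurable] = tame_measurable[OF h] tame_measurable[OF k]
  obtain R M where 1: "\<And>x. \<bar>h x\<bar> \<le> M * indicator {-R..R} x" using h by (auto simp: tame_def)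
  obtain R' M' where 2: "\<And>x. \<bar>k x\<bar> \<le> M' * indicator {-R'..R'} x" using k by (auto simp: tame_def)
  have "finite ({x. \<not> isCont h x} \<union> {x. \<not> isCont k x})" using h k by (simp add: tame_def)
  then have "finite {x. \<not> isCont (\<lambda>x. h x + k x) x}"
    by (rule rev_finite_subset) (auto intro: continuous_intros)
  moreover have "\<bar>h x + k x\<bar> \<le> (\<bar>M\<bar> + \<bar>M'\<bar>) * indicator {- max R R'..max R R'} x" for x
  proof -
    have mono: "K * indicator {-r..r} x \<le> \<bar>K\<bar> * indicator {-s..s} x" if "r \<le> s" for K r s :: real
      using that by (auto simp: indicator_def)
    have "\<bar>h x + k x\<bar> \<le> \<bar>h x\<bar> + \<bar>k x\<bar>" by simp
    also have "\<dots> \<le> \<bar>M\<bar> * indicator {- max R R'..max R R'} x + \<bar>M'\<bar> * indicator {- max R R'..max R R'} x"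
      by (intro add_mono order_trans[OF 1 mono] order_trans[OF 2 mono]) auto
    finally show ?thesis by (simp add: distrib_right)
  qed
  ultimately show ?thesis unfolding tame_def by (auto intro!: exI)
qed

lemma tame_reflect:
  assumes h: "tame h" shows "tame (\<lambda>x. h (u - x))"
proof -
  note [measurable] = tame_measurable[OF h]
  obtain R M where 1: "\<And>x. \<bar>h x\<bar> \<le> M * indicator {-R..R} x" using h by (auto simp: tame_def)
  have "finite ((\<lambda>x. u - x) ` {x. \<not> isCont h x})" using h by (simp add: tame_def)
  moreover have "isCont (\<lambda>x. h (u - x)) x" if "isCont h (u - x)" for x
    using isCont_o2[of x "\<lambda>x. u - x" h] that by simp
  then have "{x. \<not> isCont (\<lambda>x. h (u - x)) x} \<subseteq> (\<lambda>x. u - x) ` {x. \<not> isCont h x}"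
    by (auto simp: image_iff) (metis diff_diff_eq2 add_diff_cancel_left')
  ultimately have "finite {x. \<not> isCont (\<lambda>x. h (u - x)) x}" by (rule rev_finite_subset)
  moreover define S where "S = \<bar>R\<bar> + \<bar>u\<bar>"
  have "\<bar>h (u - x)\<bar> \<le> \<bar>M\<bar> * indicator {-S..S} x" for x
    by (rule order_trans[OF 1]) (auto simp: indicator_def S_def)
  ultimately show ?thesis unfolding tame_def by (auto intro!: exI)
qed

lemma tame_truncate:
  assumes f: "continuous_on UNIV f"
  shows "tame (\<lambda>x. indicator {a..b} x * f x)"
proof -
  have [measurable]: "f \<in> borel_measurable borel" using f by (rule borel_measurable_continuous_onI)
  have "compact (f ` {a..b})"
    by (rule compact_continuous_image) (use f continuous_on_subset in blast, simp)
  then obtain C where C: "\<And>x. x \<in> {a..b} \<Longrightarrow> \<bar>f x\<bar> \<le> C"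
    by (metis bounded_iff compact_imp_bounded imageI real_norm_def)
  have "\<bar>indicator {a..b} x * f x\<bar> \<le> \<bar>C\<bar> * indicator {- max \<bar>a\<bar> \<bar>b\<bar>..max \<bar>a\<bar> \<bar>b\<bar>} x" for x
    using C[of x] by (auto simp: indicator_def)
  moreover have "isCont (\<lambda>x. indicator {a..b} x * f x) x" if "x \<notin> {a, b}" for x
  proof -
    have "isCont f x" using f by (simp add: continuous_on_eq_continuous_at)
    moreover have "isCont (indicator {a..b} :: real \<Rightarrow> real) x"
      using that by (subst isCont_indicator) (auto simp: frontier_def)
    ultimately show ?thesis by (intro continuous_intros)
  qed
  then have "{x. \<not> isCont (\<lambda>x. indicator {a..b} x * f x) x} \<subseteq> {a, b}" by auto
  then have "finite {x. \<not> isCont (\<lambda>x. indicator {a..b} x * f x) x}" by (rule finite_subset) simp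
  ultimately show ?thesis unfolding tame_def by (auto intro!: exI)
qed

lemma fourier_cmult: "fourier (\<lambda>x. c * h x) \<omega> = of_real c * fourier h \<omega>"
  unfolding fourier_def by (simp add: mult.assoc flip: integral_mult_right_zero)

lemma fourier_add:
  assumes "tame h" "tame k"
  shows "fourier (\<lambda>x. h x + k x) \<omega> = fourier h \<omega> + fourier k \<omega>"
  unfolding fourier_def
  using integrable_mult_cis[OF tame_integrable[OF assms(1)], of "-\<omega>"]
    integrable_mult_cis[OF tame_integrable[OF assms(2)], of "-\<omega>"]
  by (simp add: distrib_right flip: Bochner_Integration.integral_add)

text \<open>
  As \<open>h\<close> is real, reflecting the argument conjugates its transform, and the translation by \<open>u\<close>
  contributes a unimodular factor.
\<close>

lemma fourier_reflect: "fourier (\<lambda>x. h (u - x)) \<omega> = cis (- (\<omega> * u)) * cnj (fourier h \<omega>)"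
proof -
  have "fourier (\<lambda>x. h (u - x)) \<omega> = (LINT x|lborel. of_real (h x) * cis (- (\<omega> * (u - x))))"
    unfolding fourier_def
    by (subst lborel_integral_real_affine[where c = "-1" and t = u]) auto
  also have "\<dots> = (LINT x|lborel. cis (- (\<omega> * u)) * (of_real (h x) * cis (\<omega> * x)))"
    by (simp add: cis_mult algebra_simps)
  finally show ?thesis by (simp add: cnj_fourier)
qed

text \<open>
  The Fourier transform on square integrable functions, by approximation. Any tame approximants are
  admitted, not just truncations to symmetric intervals: that makes the relation visibly stable
  under sums and under \<open>x \<mapsto> u - x\<close>, which does not preserve symmetric intervals.
\<close>

definition fourier_pair :: "(real \<Rightarrow> real) \<Rightarrow> (real \<Rightarrow> complex) \<Rightarrow> bool" where
  "fourier_pair f F \<longleftrightarrow> (\<exists>h. (\<forall>n. tame (h n)) \<and> L2_tendsto lborel h f \<and> L2_tendsto lborel (\<lambda>n. fourier (h n)) F)"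

lemma fourier_pair_square_integrable:
  assumes "fourier_pair f F" shows "square_integrable lborel f" "square_integrable lborel F"
  using assms by (auto simp: fourier_pair_def L2_tendsto_def)

lemma fourier_pair_cmult:
  assumes "fourier_pair f F" shows "fourier_pair (\<lambda>x. c * f x) (\<lambda>\<omega>. of_real c * F \<omega>)"
proof -
  obtain h where h: "\<And>n. tame (h n)" "L2_tendsto lborel h f" "L2_tendsto lborel (\<lambda>n. fourier (h n)) F"
    using assms by (auto simp: fourier_pair_def)
  show ?thesis
    unfolding fourier_pair_def
    using h tame_cmult L2_tendsto_cmult[OF h(2), of c] L2_tendsto_cmult[OF h(3), of "of_real c"]
    by (intro exI[of _ "\<lambda>n x. c * h n x"]) (simp add: fourier_cmult[abs_def])
qed

lemma fourier_pair_add: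
  assumes "fourier_pair f F" "fourier_pair g G" shows "fourier_pair (\<lambda>x. f x + g x) (\<lambda>\<omega>. F \<omega> + G \<omega>)"
proof -
  obtain h where h: "\<And>n. tame (h n)" "L2_tendsto lborel h f" "L2_tendsto lborel (\<lambda>n. fourier (h n)) F"
    using assms by (auto simp: fourier_pair_def)
  obtain k where k: "\<And>n. tame (k n)" "L2_tendsto lborel k g" "L2_tendsto lborel (\<lambda>n. fourier (k n)) G"
    using assms by (auto simp: fourier_pair_def)
  have "fourier (\<lambda>x. h n x + k n x) = (\<lambda>\<omega>. fourier (h n) \<omega> + fourier (k n) \<omega>)" for n
    using fourier_add[OF h(1) k(1)] by auto
  then show ?thesis
    unfolding fourier_pair_def
    using tame_add[OF h(1) k(1)] L2_tendsto_add[OF h(2) k(2)] L2_tendsto_add[OF h(3) k(3)]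
    by (intro exI[of _ "\<lambda>n x. h n x + k n x"]) simp
qed

lemma square_integrable_reflect:
  fixes f :: "real \<Rightarrow> real"
  assumes "square_integrable lborel f" shows "square_integrable lborel (\<lambda>x. f (u - x))"
  using assms lborel_integrable_real_affine[of "\<lambda>x. (norm (f x))\<^sup>2" "-1" u]
  by (auto simp: square_integrable_def)

lemma integral_reflect_lborel:
  fixes f :: "real \<Rightarrow> real" shows "(LINT x|lborel. f (u - x)) = (LINT x|lborel. f x)"
  by (subst (2) lborel_integral_real_affine[where c = "-1" and t = u]) auto

lemma fourier_pair_reflect:
  assumes "fourier_pair f F"
  shows "fourier_pair (\<lambda>x. f (u - x)) (\<lambda>\<omega>. cis (- (\<omega> * u)) * cnj (F \<omega>))"
proof -
  obtain h where h: "\<And>n. tame (h n)" "L2_tendsto lborel h f" "L2_tendsto lborel (\<lambda>n. fourier (h n)) F"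
    using assms by (auto simp: fourier_pair_def)
  have [measurable]: "F \<in> borel_measurable borel"
    using fourier_pair_square_integrable[OF assms] by (simp add: square_integrable_def)
  have "L2_tendsto lborel (\<lambda>n x. h n (u - x)) (\<lambda>x. f (u - x))"
    by (rule L2_tendsto_isometry[OF h(2)])
       (use h(2) in \<open>simp_all add: L2_tendsto_def square_integrable_reflect
         integral_reflect_lborel[of "\<lambda>x. (h _ x - f x)\<^sup>2"]\<close>)
  moreover have "L2_tendsto lborel (\<lambda>n \<omega>. cis (- (\<omega> * u)) * cnj (fourier (h n) \<omega>)) (\<lambda>\<omega>. cis (- (\<omega> * u)) * cnj (F \<omega>))"
  proof (rule L2_tendsto_isometry[OF h(3)])
    have sq: "square_integrable lborel (\<lambda>\<omega>. cis (- (\<omega> * u)) * cnj (G \<omega>))" if "square_integrable lborel G" for G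
      using that unfolding square_integrable_def by (auto simp: norm_mult)
    show "square_integrable lborel (\<lambda>\<omega>. cis (- (\<omega> * u)) * cnj (fourier (h n) \<omega>))" for n
      by (intro sq square_integrable_fourier h)
    show "square_integrable lborel (\<lambda>\<omega>. cis (- (\<omega> * u)) * cnj (F \<omega>))"
      by (intro sq fourier_pair_square_integrable[OF assms])
    have "cmod (cis (- (\<omega> * u)) * cnj a - cis (- (\<omega> * u)) * cnj b) = cmod (a - b)" for \<omega> a b
      by (metis complex_cnj_diff complex_mod_cnj mult.left_neutral norm_cis norm_mult right_diff_distrib)
    then show "(LINT x|lborel. (cmod (cis (- (x * u)) * cnj (fourier (h n) x) - cis (- (x * u)) * cnj (F x)))\<^sup>2) =
        (LINT x|lborel. (cmod (fourier (h n) x - F x))\<^sup>2)" for n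
      by simp
  qed
  moreover have "fourier (\<lambda>x. h n (u - x)) = (\<lambda>\<omega>. cis (- (\<omega> * u)) * cnj (fourier (h n) \<omega>))" for n
    by (rule ext) (rule fourier_reflect)
  ultimately show ?thesis
    unfolding fourier_pair_def by (intro exI[of _ "\<lambda>n x. h n (u - x)"]) (simp add: tame_reflect h)
qed

lemma plancherel_pair:
  assumes "fourier_pair f F"
  shows "(LINT \<omega>|lborel. (cmod (F \<omega>))\<^sup>2) = 2 * pi * (LINT x|lborel. (f x)\<^sup>2)"
proof -
  obtain h where h: "\<And>n. tame (h n)" "L2_tendsto lborel h f" "L2_tendsto lborel (\<lambda>n. fourier (h n)) F"
    using assms by (auto simp: fourier_pair_def)
  have eq: "(LINT \<omega>|lborel. (cmod (fourier (h n) \<omega>))\<^sup>2) = 2 * pi * (LINT x|lborel. (norm (h n x))\<^sup>2)" for n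
  proof -
    have "complex_of_real (LINT \<omega>|lborel. (cmod (fourier (h n) \<omega>))\<^sup>2) =
       (LINT \<omega>|lborel. fourier (h n) \<omega> * cnj (fourier (h n) \<omega>))"
      unfolding integral_complex_of_real[symmetric] complex_norm_square ..
    also have "\<dots> = of_real (2 * pi * (LINT x|lborel. (norm (h n x))\<^sup>2))"
      unfolding plancherel_tame[OF h(1) h(1)] by (simp add: power2_eq_square)
    finally show ?thesis unfolding of_real_eq_iff .
  qed
  have "(\<lambda>n. 2 * pi * (LINT x|lborel. (norm (h n x))\<^sup>2)) \<longlonglongrightarrow> 2 * pi * (LINT x|lborel. (norm (f x))\<^sup>2)"
    by (intro tendsto_mult_left L2_tendsto_norm h)
  then show ?thesis
    using LIMSEQ_unique[OF L2_tendsto_norm[OF h(3)]] unfolding eq by simp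
qed

text \<open>
  Plancherel's identity against a fixed tame function; it identifies \<open>f\<close> in terms of \<open>F\<close> and is the
  source of the inversion formula.
\<close>

lemma fourier_pair_weak:
  assumes "fourier_pair f F" and k: "tame k"
  shows "(LINT \<omega>|lborel. F \<omega> * cnj (fourier k \<omega>)) = of_real (2 * pi * (LINT x|lborel. f x * k x))"
proof -
  obtain h where h: "\<And>n. tame (h n)" "L2_tendsto lborel h f" "L2_tendsto lborel (\<lambda>n. fourier (h n)) F"
    using assms by (auto simp: fourier_pair_def)
  have "(\<lambda>n. LINT \<omega>|lborel. fourier (h n) \<omega> * cnj (fourier k \<omega>)) \<longlonglongrightarrow> (LINT \<omega>|lborel. F \<omega> * cnj (fourier k \<omega>))"
    by (intro L2_tendsto_integral_mult h square_integrable_cnj square_integrable_fourier k)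
  moreover have "(\<lambda>n. complex_of_real (2 * pi * (LINT x|lborel. h n x * k x))) \<longlonglongrightarrow> of_real (2 * pi * (LINT x|lborel. f x * k x))"
    by (intro tendsto_of_real tendsto_mult_left L2_tendsto_integral_mult h tame_square_integrable k)
  ultimately show ?thesis
    unfolding plancherel_tame[OF h(1) k] by (rule LIMSEQ_unique)
qed

lemma truncated_fourier_eq: "truncated_fourier f R = fourier (\<lambda>x. indicator {-R..R} x * f x)"
  unfolding truncated_fourier_def fourier_def set_lebesgue_integral_def
  by (auto simp: cis_conv_exp scaleR_conv_of_real intro!: Bochner_Integration.integral_cong)

text \<open>
  The truncations of \<open>f\<close> to \<open>[-n, n]\<close> serve as approximants. The transform is given only up to a null
  set, so it can be replaced by zero everywhere outside the band.
\<close>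

lemma BL_pi_fourier_pair:
  assumes "f \<in> BL_pi"
  obtains F where "continuous_on UNIV f" "fourier_pair f F" "\<And>\<omega>. \<omega> \<notin> {-pi..pi} \<Longrightarrow> F \<omega> = 0"
proof -
  from assms obtain G where f: "continuous_on UNIV f" "integrable lborel (\<lambda>x. (f x)\<^sup>2)"
    and G: "has_L2_fourier_transform f G" and supp: "AE \<omega> in lborel. \<omega> \<notin> {-pi..pi} \<longrightarrow> G \<omega> = 0"
    by (auto simp: BL_pi_def)
  have [measurable]: "f \<in> borel_measurable borel" using f(1) by (rule borel_measurable_continuous_onI)
  have [measurable]: "G \<in> borel_measurable borel" using G by (simp add: has_L2_fourier_transform_def)
  define F where "F \<omega> = indicator {-pi..pi} \<omega> * G \<omega>" for \<omega>
  have [measurable]: "F \<in> borel_measurable borel" unfolding F_def by measurable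
  have FG: "AE \<omega> in lborel. F \<omega> = G \<omega>"
    using supp by eventually_elim (auto simp: F_def indicator_def)
  define h where "h n x = indicator {- real n..real n} x * f x" for n :: nat and x
  have tame: "tame (h n)" for n unfolding h_def by (rule tame_truncate[OF f(1)])
  have sf: "square_integrable lborel f" using f by (simp add: square_integrable_def)
  have "integrable lborel (\<lambda>\<omega>. (cmod (G \<omega>))\<^sup>2)" using G by (simp add: has_L2_fourier_transform_def)
  moreover have "(cmod (F \<omega>))\<^sup>2 \<le> (cmod (G \<omega>))\<^sup>2" for \<omega> by (auto simp: F_def indicator_def)
  ultimately have "integrable lborel (\<lambda>\<omega>. (cmod (F \<omega>))\<^sup>2)"
    by (elim Bochner_Integration.integrable_bound) simp_all
  then have sF: "square_integrable lborel F" by (simp add: square_integrable_def)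
  have "(\<lambda>n. LINT x|lborel. (norm (h n x - f x))\<^sup>2) \<longlonglongrightarrow> (LINT x::real|lborel. (0::real))"
  proof (rule integral_dominated_convergence[where w = "\<lambda>x. (f x)\<^sup>2"])
    show "AE x in lborel. (\<lambda>n. (norm (h n x - f x))\<^sup>2) \<longlonglongrightarrow> 0"
    proof (intro AE_I2 tendsto_eventually)
      fix x :: real
      have "eventually (\<lambda>n. real n \<ge> \<bar>x\<bar>) sequentially"
        using filterlim_real_sequentially unfolding filterlim_at_top by blast
      then show "eventually (\<lambda>n. (norm (h n x - f x))\<^sup>2 = 0) sequentially"
        by eventually_elim (auto simp: h_def indicator_def)
    qed
    show "AE x in lborel. norm ((norm (h n x - f x))\<^sup>2) \<le> (f x)\<^sup>2" for n
      by (auto simp: h_def indicator_def)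
  qed (use f in \<open>simp_all add: h_def\<close>)
  then have 1: "L2_tendsto lborel h f"
    unfolding L2_tendsto_def using sf tame_square_integrable[OF tame] by simp
  have sd: "square_integrable lborel (\<lambda>\<omega>. fourier (h n) \<omega> - F \<omega>)" for n
    by (intro square_integrable_diff square_integrable_fourier tame sF)
  have "((\<lambda>R. \<integral>\<^sup>+ \<omega>. ennreal ((cmod (truncated_fourier f R \<omega> - G \<omega>))\<^sup>2) \<partial>lborel) \<longlongrightarrow> 0) at_top"
    using G by (simp add: has_L2_fourier_transform_def)
  from filterlim_compose[OF this filterlim_real_sequentially]
  have "(\<lambda>n. \<integral>\<^sup>+ \<omega>. ennreal ((cmod (fourier (h n) \<omega> - G \<omega>))\<^sup>2) \<partial>lborel) \<longlonglongrightarrow> 0"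
    by (simp add: truncated_fourier_eq h_def[abs_def])
  also have "(\<lambda>n. \<integral>\<^sup>+ \<omega>. ennreal ((cmod (fourier (h n) \<omega> - G \<omega>))\<^sup>2) \<partial>lborel) =
     (\<lambda>n. ennreal (LINT \<omega>|lborel. (cmod (fourier (h n) \<omega> - F \<omega>))\<^sup>2))"
  proof
    fix n
    have "(\<integral>\<^sup>+ \<omega>. ennreal ((cmod (fourier (h n) \<omega> - G \<omega>))\<^sup>2) \<partial>lborel) = (\<integral>\<^sup>+ \<omega>. ennreal ((cmod (fourier (h n) \<omega> - F \<omega>))\<^sup>2) \<partial>lborel)"
      by (rule nn_integral_cong_AE) (use FG in \<open>eventually_elim, simp\<close>)
    also have "\<dots> = ennreal (LINT \<omega>|lborel. (cmod (fourier (h n) \<omega> - F \<omega>))\<^sup>2)"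
      by (rule nn_integral_eq_integral[OF square_integrable_integrable[OF sd]]) simp
    finally show "(\<integral>\<^sup>+ \<omega>. ennreal ((cmod (fourier (h n) \<omega> - G \<omega>))\<^sup>2) \<partial>lborel) = ennreal (LINT \<omega>|lborel. (cmod (fourier (h n) \<omega> - F \<omega>))\<^sup>2)" .
  qed
  finally have "(\<lambda>n. LINT \<omega>|lborel. (cmod (fourier (h n) \<omega> - F \<omega>))\<^sup>2) \<longlonglongrightarrow> 0"
    by (subst (asm) ennreal_0[symmetric], subst (asm) tendsto_ennreal_iff) auto
  then have 2: "L2_tendsto lborel (\<lambda>n. fourier (h n)) F"
    unfolding L2_tendsto_def using sF square_integrable_fourier[OF tame] by simp
  show ?thesis
    by (rule that[of F, OF f(1)]) (use tame 1 2 in \<open>auto simp: fourier_pair_def F_def\<close>)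
qed

section \<open>Orthogonality of the Legendre polynomials\<close>

lemma has_integral_pderiv: "a \<le> b \<Longrightarrow> ((\<lambda>x. poly (pderiv p) x) has_integral poly p b - poly p (a::real)) {a..b}"
  by (intro fundamental_theorem_of_calculus)
     (auto intro!: DERIV_subset[OF poly_DERIV] simp flip: has_real_derivative_iff_has_vector_derivative)

lemma integral_by_parts_poly:
  fixes p q :: "real poly"
  assumes "a \<le> b" "poly p a * poly q a = 0" "poly p b * poly q b = 0"
  shows "integral {a..b} (\<lambda>x. poly (pderiv p) x * poly q x) = - integral {a..b} (\<lambda>x. poly p x * poly (pderiv q) x)"
proof -
  have c: "(\<lambda>x. poly r x) integrable_on {a..b}" for r :: "real poly"
    by (intro integrable_continuous_interval continuous_intros)
  have "integral {a..b} (\<lambda>x. poly (pderiv (p * q)) x) = 0"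
    using has_integral_pderiv[OF assms(1), of "p * q"] assms(2,3) by (intro integral_unique) simp
  also have "(\<lambda>x. poly (pderiv (p * q)) x) = (\<lambda>x. poly (pderiv p * q) x + poly (p * pderiv q) x)"
    by (auto simp: pderiv_mult algebra_simps)
  also have "integral {a..b} \<dots> = integral {a..b} (poly (pderiv p * q)) + integral {a..b} (poly (p * pderiv q))"
    by (intro Henstock_Kurzweil_Integration.integral_add c)
  finally show ?thesis by (simp add: poly_mult[abs_def])
qed

text \<open>
  The polynomial \<open>(x\<^sup>2 - 1)\<^sup>n\<close> of Rodrigues' formula.
\<close>

definition rodrigues :: "nat \<Rightarrow> real poly" where "rodrigues n = [:-1, 0, 1:] ^ n"

lemma poly_rodrigues: "poly (rodrigues n) x = (x\<^sup>2 - 1) ^ n"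
  by (simp add: rodrigues_def poly_power power2_eq_square algebra_simps)

lemma degree_rodrigues: "degree (rodrigues n) = 2 * n"
  by (simp add: rodrigues_def degree_power_eq)

lemma coeff_rodrigues_top: "coeff (rodrigues n) (2 * n) = 1"
  using lead_coeff_power[of "[:-1, 0, 1::real:]" n] by (simp add: rodrigues_def degree_power_eq mult_2)

text \<open>
  Each differentiation lowers the multiplicity of a factor by at most one. Hence the derivatives of
  \<open>(x\<^sup>2 - 1)\<^sup>n\<close> of order below \<open>n\<close> vanish at both ends of \<open>[-1, 1]\<close>, and integration by parts
  produces no boundary terms.
\<close>

lemma pderiv_power_dvd:
  "k \<le> n \<Longrightarrow> p ^ (n - k) dvd (pderiv ^^ k) (p ^ n * (q :: real poly))"
proof (induction k)
  case (Suc k)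
  then obtain r where r: "(pderiv ^^ k) (p ^ n * q) = p ^ Suc (n - Suc k) * r"
    by (auto simp: Suc_diff_Suc elim!: dvdE)
  show ?case
    by (simp add: r pderiv_mult pderiv_power_Suc del: power_Suc)
       (intro dvd_add dvd_smult; simp)
qed simp

lemma pderiv_rodrigues_end:
  assumes "k < n" "x\<^sup>2 = 1"
  shows "poly ((pderiv ^^ k) (rodrigues n)) x = 0"
proof -
  have "[:-1, 0, 1::real:] ^ (n - k) dvd (pderiv ^^ k) (rodrigues n)"
    using pderiv_power_dvd[of k n "[:-1, 0, 1:]" 1] assms by (simp add: rodrigues_def)
  then obtain r where "(pderiv ^^ k) (rodrigues n) = [:-1, 0, 1::real:] ^ (n - k) * r" by (elim dvdE)
  then show ?thesis using assms by (simp add: poly_power power2_eq_square)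
qed

lemma integral_rodrigues_by_parts:
  "k \<le> n \<Longrightarrow> integral {-1..1} (\<lambda>x. poly ((pderiv ^^ n) (rodrigues n)) x * poly q x) =
    (-1) ^ k * integral {-1..1} (\<lambda>x. poly ((pderiv ^^ (n - k)) (rodrigues n)) x * poly ((pderiv ^^ k) q) x)"
proof (induction k)
  case (Suc k)
  have "integral {-1..1} (\<lambda>x. poly (pderiv ((pderiv ^^ (n - Suc k)) (rodrigues n))) x * poly ((pderiv ^^ k) q) x) =
     - integral {-1..1} (\<lambda>x. poly ((pderiv ^^ (n - Suc k)) (rodrigues n)) x * poly (pderiv ((pderiv ^^ k) q)) x)"
    using Suc.prems by (intro integral_by_parts_poly) (auto simp: pderiv_rodrigues_end)
  moreover have "pderiv ((pderiv ^^ (n - Suc k)) (rodrigues n)) = (pderiv ^^ (n - k)) (rodrigues n)"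
    using Suc.prems by (simp flip: Suc_diff_Suc)
  ultimately show ?case using Suc by simp
qed simp

lemma degree_pderiv_funpow: "degree ((pderiv ^^ k) (p :: real poly)) = degree p - k"
  by (induction k) (auto simp: degree_pderiv)

lemma pderiv_funpow_top:
  assumes "degree (p :: real poly) \<le> k"
  shows "(pderiv ^^ k) p = [:fact k * coeff p k:]"
proof -
  have "degree ((pderiv ^^ k) p) = 0" using assms by (simp add: degree_pderiv_funpow)
  then obtain c where c: "(pderiv ^^ k) p = [:c:]" by (elim degree_eq_zeroE)
  have "c = fact k * coeff p k"
    using coeff_higher_pderiv[of k p 0] c by (simp add: pochhammer_fact)
  then show ?thesis using c by simp
qed

lemma legendre_rodrigues: "legendre n = smult (1 / (2 ^ n * fact n)) ((pderiv ^^ n) (rodrigues n))"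
  by (simp add: legendre_def rodrigues_def)

lemma degree_legendre: "degree (legendre n) = n"
  by (simp add: legendre_rodrigues degree_pderiv_funpow degree_rodrigues)

lemma coeff_legendre_top: "coeff (legendre n) n = fact (2 * n) / (2 ^ n * (fact n)\<^sup>2)"
proof -
  have "pochhammer (real (Suc n)) n * fact n = fact (2 * n)"
    using pochhammer_product'[of "1 :: real" n n] by (simp add: pochhammer_fact mult_2 add.commute)
  then have "coeff ((pderiv ^^ n) (rodrigues n)) n = fact (2 * n) / fact n"
    using coeff_higher_pderiv[of n "rodrigues n" n] coeff_rodrigues_top[of n]
    by (simp add: mult_2 nonzero_eq_divide_eq)
  then show ?thesis by (simp add: legendre_rodrigues power2_eq_square)
qed

text \<open>
  Integrating \<open>1 \<cdot> (1 - x\<^sup>2)\<^sup>n\<^sup>+\<^sup>1\<close> by parts and writing \<open>x\<^sup>2 = 1 - (1 - x\<^sup>2)\<close> gives the recursion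
  \<open>(2n + 3) J\<^sub>n\<^sub>+\<^sub>1 = (2n + 2) J\<^sub>n\<close>.
\<close>

lemma integral_rodrigues:
  "integral {-1..1} (\<lambda>x::real. (1 - x\<^sup>2) ^ n) = 2 ^ (2 * n + 1) * (fact n)\<^sup>2 / fact (2 * n + 1)"
proof (induction n)
  case (Suc n)
  define J where "J n = integral {-1..1} (\<lambda>x::real. (1 - x\<^sup>2) ^ n)" for n
  have "integral {-1..1} (\<lambda>x. poly (pderiv [:0, 1:]) x * poly ([:1, 0, -1:] ^ Suc n) x) =
     - integral {-1..1} (\<lambda>x::real. poly [:0, 1:] x * poly (pderiv ([:1, 0, -1:] ^ Suc n)) x)"
    by (intro integral_by_parts_poly) (auto simp: poly_power)
  then have "J (Suc n) = - integral {-1..1} (\<lambda>x::real. poly [:0, 1:] x * poly (pderiv ([:1, 0, -1:] ^ Suc n)) x)"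
    by (simp add: J_def poly_power power2_eq_square pderiv_pCons del: power_Suc)
  also have "(\<lambda>x::real. poly [:0, 1:] x * poly (pderiv ([:1, 0, -1:] ^ Suc n)) x) =
     (\<lambda>x. 2 * real (Suc n) * (1 - x\<^sup>2) ^ Suc n - 2 * real (Suc n) * (1 - x\<^sup>2) ^ n)"
  proof
    fix x :: real
    define w :: "real poly" where "w = [:1, 0, -1:]"
    have w: "poly w x = 1 - x\<^sup>2" "pderiv w = [:0, -2:]"
      by (simp_all add: w_def pderiv_pCons power2_eq_square)
    show "poly [:0, 1:] x * poly (pderiv ([:1, 0, -1:] ^ Suc n)) x =
        2 * real (Suc n) * (1 - x\<^sup>2) ^ Suc n - 2 * real (Suc n) * (1 - x\<^sup>2) ^ n"
      unfolding w_def[symmetric] pderiv_power_Suc w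
      by (simp add: poly_power w algebra_simps power2_eq_square)
  qed
  also have "integral {-1..1} \<dots> = 2 * real (Suc n) * J (Suc n) - 2 * real (Suc n) * J n"
    unfolding J_def
    by (subst Henstock_Kurzweil_Integration.integral_diff)
       (auto intro!: integrable_continuous_interval continuous_intros simp del: power_Suc)
  finally have "(2 * real (Suc n) + 1) * J (Suc n) = 2 * real (Suc n) * J n" by (simp add: algebra_simps)
  then have "J (Suc n) = 2 * real (Suc n) / (2 * real (Suc n) + 1) * J n"
    by (simp add: field_simps del: of_nat_Suc)
  also have "J n = 2 ^ (2 * n + 1) * (fact n)\<^sup>2 / fact (2 * n + 1)" using Suc by (simp add: J_def)
  also have "2 * real (Suc n) / (2 * real (Suc n) + 1) * \<dots> = 2 ^ (2 * Suc n + 1) * (fact (Suc n))\<^sup>2 / fact (2 * Suc n + 1)"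
  proof -
    have f: "fact (2 * Suc n + 1) = (2 * real (Suc n) + 1) * (2 * real (Suc n)) * fact (2 * n + 1)"
      by (simp add: algebra_simps)
    have "2 * real (Suc n) / (2 * real (Suc n) + 1) * (2 ^ (2 * n + 1) * (fact n)\<^sup>2 / F)
      = 2 ^ (2 * Suc n + 1) * (fact (Suc n))\<^sup>2 / ((2 * real (Suc n) + 1) * (2 * real (Suc n)) * F)" if "F > 0" for F
      using that by (simp add: divide_simps power2_eq_square del: of_nat_Suc)
    then show ?thesis unfolding f by simp
  qed
  finally show ?case by (simp add: J_def)
qed simp

text \<open>
  Integrating by parts \<open>n\<close> times moves all derivatives to \<open>q\<close>, where only the constant
  \<open>n! coeff q n\<close> survives. Orthogonality and the norm are the cases \<open>deg q < n\<close> and \<open>q = P\<^sub>n\<close>.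
\<close>

lemma integral_legendre_mult:
  assumes "degree q \<le> n"
  shows "integral {-1..1} (\<lambda>x. poly (legendre n) x * poly q x) =
     coeff q n * 2 ^ (n + 1) * (fact n)\<^sup>2 / fact (2 * n + 1)"
proof -
  have "integral {-1..1} (\<lambda>x. poly (legendre n) x * poly q x) =
     1 / (2 ^ n * fact n) * integral {-1..1} (\<lambda>x. poly ((pderiv ^^ n) (rodrigues n)) x * poly q x)"
    by (simp add: legendre_rodrigues)
  also have "integral {-1..1} (\<lambda>x. poly ((pderiv ^^ n) (rodrigues n)) x * poly q x) =
     (-1) ^ n * integral {-1..1} (\<lambda>x. (x\<^sup>2 - 1) ^ n * (fact n * coeff q n))"
    using integral_rodrigues_by_parts[of n n q]
    by (simp add: pderiv_funpow_top[OF assms] poly_rodrigues)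
  also have "\<dots> = fact n * coeff q n * integral {-1..1} (\<lambda>x. (1 - x\<^sup>2) ^ n)"
  proof -
    have "(-1) ^ n * (x\<^sup>2 - 1) ^ n = (1 - x\<^sup>2) ^ n" for x :: real
      by (simp flip: power_mult_distrib)
    then have "(-1) ^ n * integral {-1..1} (\<lambda>x. (x\<^sup>2 - 1) ^ n) = integral {-1..1} (\<lambda>x::real. (1 - x\<^sup>2) ^ n)"
      by (simp flip: Henstock_Kurzweil_Integration.integral_mult_right)
    then show ?thesis by simp
  qed
  finally have "integral {-1..1} (\<lambda>x. poly (legendre n) x * poly q x) =
     1 / (2 ^ n * fact n) * (fact n * coeff q n * (2 ^ (2 * n + 1) * (fact n)\<^sup>2 / fact (2 * n + 1)))"
    unfolding integral_rodrigues .
  moreover have "(2 :: real) ^ (2 * n + 1) = 2 ^ n * 2 ^ (n + 1)"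
    unfolding power_add[symmetric] by (rule arg_cong[where f = "\<lambda>k. 2 ^ k"]) simp
  moreover have "1 / (2 ^ n * F) * (F * c * (2 ^ n * 2 ^ (n + 1) * F\<^sup>2 / G)) = c * 2 ^ (n + 1) * F\<^sup>2 / G"
    if "F > 0" for F G c :: real
    using that by simp
  ultimately show ?thesis by (simp del: fact_Suc)
qed

lemma legendre_orthogonal:
  assumes "m < n"
  shows "integral {-1..1} (\<lambda>x. poly (legendre n) x * poly (legendre m) x) = 0"
  using assms by (subst integral_legendre_mult) (auto simp: degree_legendre coeff_eq_0)

lemma legendre_norm:
  "integral {-1..1} (\<lambda>x. poly (legendre n) x * poly (legendre n) x) = 2 / (2 * real n + 1)"
proof -
  have "(2 :: real) ^ (n + 1) * (fact n)\<^sup>2 * (F / (2 ^ n * (fact n)\<^sup>2)) / ((2 * real n + 1) * F) = 2 / (2 * real n + 1)"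
    if "F > 0" for F
    using that by (simp add: divide_simps)
  from this[of "fact (2 * n)"] show ?thesis
    by (simp add: integral_legendre_mult degree_legendre coeff_legendre_top mult.commute mult.left_commute add.commute)
qed

section \<open>Parseval's identity for orthonormal systems\<close>

text \<open>
  Completing the square. With \<open>b\<close> the Fourier coefficients the last sum vanishes, so these give the best
  approximation; any other choice of \<open>b\<close> still bounds the defect in Bessel's inequality from above.
\<close>

lemma orthonormal_distance:
  fixes e :: "nat \<Rightarrow> 'a \<Rightarrow> real"
  assumes e: "\<And>n. square_integrable M (e n)"
    and orth: "\<And>m n. (LINT x|M. e m x * e n x) = (if m = n then 1 else 0)"
    and u: "square_integrable M u"
  shows "(LINT x|M. (u x - (\<Sum>n<N. b n * e n x))\<^sup>2) =
    (LINT x|M. (u x)\<^sup>2) - (\<Sum>n<N. (LINT x|M. u x * e n x)\<^sup>2) + (\<Sum>n<N. (b n - (LINT x|M. u x * e n x))\<^sup>2)"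
proof -
  define c where "c n = (LINT x|M. u x * e n x)" for n
  define s where "s x = (\<Sum>n<N. b n * e n x)" for x
  have s: "square_integrable M s"
    unfolding s_def by (intro square_integrable_sum square_integrable_cmult e)
  note int = integrable_mult_square_integrable
  have us: "(LINT x|M. v x * s x) = (\<Sum>n<N. b n * (LINT x|M. v x * e n x))" if "square_integrable M v" for v
  proof -
    have "(LINT x|M. v x * s x) = (LINT x|M. (\<Sum>n<N. b n * (v x * e n x)))"
      by (simp add: s_def sum_distrib_left mult.left_commute)
    also have "\<dots> = (\<Sum>n<N. LINT x|M. b n * (v x * e n x))"
      by (intro Bochner_Integration.integral_sum integrable_mult_right int that e)
    finally show ?thesis by simp
  qed
  have es: "(LINT x|M. s x * e n x) = b n" if "n < N" for n
  proof -
    have "(LINT x|M. e n x * s x) = (\<Sum>m<N. b m * (if n = m then 1 else 0))"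
      unfolding us[OF e] orth ..
    also have "\<dots> = (\<Sum>m<N. if n = m then b m else 0)" by (intro sum.cong) auto
    also have "\<dots> = b n" using that by simp
    finally show ?thesis by (simp add: mult.commute)
  qed
  have "(LINT x|M. (u x - s x)\<^sup>2) = (LINT x|M. u x * u x - 2 * (u x * s x) + s x * s x)"
    by (simp add: power2_eq_square algebra_simps)
  also have "\<dots> = (LINT x|M. u x * u x) - 2 * (LINT x|M. u x * s x) + (LINT x|M. s x * s x)"
    using int[OF u u] int[OF u s] int[OF s s] by simp
  also have "\<dots> = (LINT x|M. u x * u x) - 2 * (\<Sum>n<N. b n * c n) + (\<Sum>n<N. b n * b n)"
    using us[OF u] us[OF s] es by (simp add: c_def)
  also have "\<dots> = (LINT x|M. (u x)\<^sup>2) - (\<Sum>n<N. (c n)\<^sup>2) + (\<Sum>n<N. (b n - c n)\<^sup>2)"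
    by (simp add: power2_eq_square algebra_simps sum.distrib sum_subtractf sum_distrib_left)
  finally show ?thesis by (simp add: s_def c_def)
qed

text \<open>
  By \<open>orthonormal_distance\<close> the defect \<open>\<integral> u\<^sup>2 - \<Sum>n<N. (\<integral> u e\<^sub>n)\<^sup>2\<close> lies between zero and the distance of \<open>u\<close> to any
  combination of the first \<open>N\<close> functions. Approximability is asked of \<open>u\<close> itself because it can then be
  read off from continuous approximants of \<open>u\<close>.
\<close>

lemma orthonormal_parseval:
  fixes e :: "nat \<Rightarrow> 'a \<Rightarrow> real"
  assumes e: "\<And>n. square_integrable M (e n)"
    and orth: "\<And>m n. (LINT x|M. e m x * e n x) = (if m = n then 1 else 0)"
    and u: "square_integrable M u"
    and dense: "\<And>\<epsilon>. \<epsilon> > 0 \<Longrightarrow> \<exists>N b. (LINT x|M. (u x - (\<Sum>n<N. b n * e n x))\<^sup>2) < \<epsilon>"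
  shows "(\<lambda>n. (LINT x|M. u x * e n x)\<^sup>2) sums (LINT x|M. (u x)\<^sup>2)"
proof -
  define c where "c n = (LINT x|M. u x * e n x)" for n
  note dist = orthonormal_distance[OF e orth u, folded c_def]
  have le: "(\<Sum>n<N. (c n)\<^sup>2) \<le> (LINT x|M. (u x)\<^sup>2)" for N
  proof -
    have "0 \<le> (LINT x|M. (u x - (\<Sum>n<N. c n * e n x))\<^sup>2)" by simp
    then show ?thesis unfolding dist by simp
  qed
  have "(\<lambda>N. \<Sum>n<N. (c n)\<^sup>2) \<longlonglongrightarrow> (LINT x|M. (u x)\<^sup>2)"
  proof (rule LIMSEQ_I)
    fix \<epsilon> :: real assume "\<epsilon> > 0"
    from dense[OF this] obtain N b where N: "(LINT x|M. (u x - (\<Sum>n<N. b n * e n x))\<^sup>2) < \<epsilon>" by blast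
    have "0 \<le> (\<Sum>n<N. (b n - c n)\<^sup>2)" by (intro sum_nonneg) auto
    then have "(LINT x|M. (u x)\<^sup>2) - (\<Sum>n<N. (c n)\<^sup>2) < \<epsilon>"
      using N unfolding dist by linarith
    moreover have "(\<Sum>n<N. (c n)\<^sup>2) \<le> (\<Sum>n<k. (c n)\<^sup>2)" if "k \<ge> N" for k
      using that by (intro sum_mono2) auto
    ultimately have "norm ((\<Sum>n<k. (c n)\<^sup>2) - (LINT x|M. (u x)\<^sup>2)) < \<epsilon>" if "k \<ge> N" for k
      using that le[of k] by fastforce
    then show "\<exists>no. \<forall>k\<ge>no. norm ((\<Sum>n<k. (c n)\<^sup>2) - (LINT x|M. (u x)\<^sup>2)) < \<epsilon>" by blast
  qed
  then show ?thesis by (simp add: sums_def c_def)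
qed

section \<open>The normalized Legendre polynomials on the band\<close>

text \<open>
  Subtracting the right multiple of \<open>p\<^sub>N\<close> removes the leading coefficient.
\<close>

lemma poly_span_of_degrees:
  fixes p :: "nat \<Rightarrow> real poly"
  assumes deg: "\<And>n. degree (p n) = n" and nz: "\<And>n. p n \<noteq> 0" and "degree q < N"
  shows "\<exists>b. q = (\<Sum>n<N. smult (b n) (p n))"
  using assms(3)
proof (induction N arbitrary: q)
  case (Suc N)
  define c where "c = coeff q N / coeff (p N) N"
  define r where "r = q - smult c (p N)"
  have top: "coeff (p N) N \<noteq> 0" using nz[of N] deg[of N] leading_coeff_0_iff[of "p N"] by simp
  have z: "coeff r N = 0" using top by (simp add: r_def c_def)
  have d: "degree r \<le> N"
    using Suc.prems deg[of N] by (auto simp: r_def intro!: degree_diff_le)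
  have "\<exists>b. r = (\<Sum>n<N. smult (b n) (p n))"
  proof (cases "r = 0")
    case True then show ?thesis by (auto intro: exI[of _ "\<lambda>_. 0"])
  next
    case False
    then have "degree r \<noteq> N" using z leading_coeff_0_iff[of r] by auto
    then show ?thesis using d by (intro Suc.IH) simp
  qed
  then obtain b where b: "r = (\<Sum>n<N. smult (b n) (p n))" ..
  have "q = (\<Sum>n<N. smult (b n) (p n)) + smult c (p N)" by (simp flip: b add: r_def)
  then have "q = (\<Sum>n<Suc N. smult ((b(N := c)) n) (p n))" by simp
  then show ?case by blast
qed simp

text \<open>
  Lebesgue measure on \<open>[-\<pi>, \<pi>]\<close> divided by \<open>2\<pi>\<close>, for which the normalized Legendre polynomials are
  orthonormal. It is a density on the real line, so that functions need not be restricted.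
\<close>

definition band :: "real measure" where
  "band = density lborel (\<lambda>\<omega>. ennreal (indicator {-pi..pi} \<omega> / (2 * pi)))"

lemma space_band [simp]: "space band = UNIV" and sets_band [measurable_cong, simp]: "sets band = sets borel"
  by (simp_all add: band_def)

lemma borel_measurable_band [simp]: "borel_measurable band = borel_measurable borel"
  by (rule measurable_cong_sets) simp_all

lemma integral_band:
  fixes f :: "real \<Rightarrow> 'b::{banach, second_countable_topology}"
  assumes "f \<in> borel_measurable borel"
  shows "(LINT \<omega>|band. f \<omega>) = (1 / (2 * pi)) *\<^sub>R (LINT \<omega>:{-pi..pi}|lborel. f \<omega>)"
  unfolding band_def set_lebesgue_integral_def
  using assms by (subst integral_density) (auto simp flip: integral_scaleR_right)

lemma integrable_band_iff:
  fixes f :: "real \<Rightarrow> 'b::{banach, second_countable_topology}"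
  assumes "f \<in> borel_measurable borel"
  shows "integrable band f \<longleftrightarrow> set_integrable lborel {-pi..pi} f"
proof -
  have "integrable band f \<longleftrightarrow> integrable lborel (\<lambda>\<omega>. (1 / (2 * pi)) *\<^sub>R indicator {-pi..pi} \<omega> *\<^sub>R f \<omega>)"
    unfolding band_def using assms by (subst integrable_density) auto
  also have "\<dots> \<longleftrightarrow> integrable lborel (\<lambda>\<omega>. indicator {-pi..pi} \<omega> *\<^sub>R f \<omega>)"
    using integrable_scaleR_right[of "2 * pi" lborel "\<lambda>\<omega>. (1 / (2 * pi)) *\<^sub>R indicator {-pi..pi} \<omega> *\<^sub>R f \<omega>"]
      integrable_scaleR_right[of "1 / (2 * pi)" lborel "\<lambda>\<omega>. indicator {-pi..pi} \<omega> *\<^sub>R f \<omega>"]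
    by auto
  finally show ?thesis by (simp add: set_integrable_def)
qed

lemma integrable_band_continuous:
  fixes f :: "real \<Rightarrow> 'b::euclidean_space"
  assumes "continuous_on UNIV f" shows "integrable band f"
proof -
  have "continuous_on {-pi..pi} f" using assms continuous_on_subset by blast
  then show ?thesis
    using borel_measurable_continuous_onI[OF assms]
    by (simp add: integrable_band_iff borel_integrable_atLeastAtMost')
qed

lemma square_integrable_band_continuous:
  fixes f :: "real \<Rightarrow> 'b::{euclidean_space,real_normed_field}"
  assumes "continuous_on UNIV f" shows "square_integrable band f"
  using assms
  by (auto simp: square_integrable_def borel_measurable_continuous_onI
      intro!: integrable_band_continuous continuous_intros)

lemma prob_space_band: "prob_space band"
proof
  have "emeasure band (space band) = (\<integral>\<^sup>+ x. ennreal (1 / (2 * pi)) * indicator {-pi..pi} x \<partial>lborel)"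
    unfolding band_def by (subst emeasure_density) (auto intro!: nn_integral_cong split: split_indicator)
  also have "\<dots> = ennreal (1 / (2 * pi)) * ennreal (2 * pi)"
    by (subst nn_integral_cmult_indicator) (auto simp: emeasure_lborel_Icc_eq)
  also have "\<dots> = 1" by (simp flip: ennreal_mult'')
  finally show "emeasure band (space band) = 1" .
qed

lemma legendre_normalized_orthonormal:
  "(LINT \<omega>|band. poly (legendre_normalized m) \<omega> * poly (legendre_normalized n) \<omega>) = (if m = n then 1 else 0)"
proof -
  define P where "P m n x = poly (legendre m) x * poly (legendre n) x" for m n x
  define c where "c = sqrt (2 * real m + 1) * sqrt (2 * real n + 1)"
  have contP: "continuous_on S (P m n)" for S unfolding P_def by (intro continuous_intros)
  have "(LINT \<omega>|band. poly (legendre_normalized m) \<omega> * poly (legendre_normalized n) \<omega>) = (LINT \<omega>|band. c * P m n (\<omega> / pi))"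
    by (simp add: legendre_normalized_def P_def poly_pcompose c_def ac_simps)
  also have "\<dots> = c / (2 * pi) * (LINT \<omega>|lborel. indicator {-pi..pi} \<omega> * P m n (\<omega> / pi))"
    by (subst integral_band)
       (auto simp: set_lebesgue_integral_def mult.left_commute P_def simp flip: integral_mult_right_zero
         intro!: borel_measurable_continuous_onI continuous_intros)
  also have "(LINT \<omega>|lborel. indicator {-pi..pi} \<omega> * P m n (\<omega> / pi)) = pi * (LINT x|lborel. indicator {-1..1} x * P m n x)"
  proof -
    have "-pi \<le> pi * x \<longleftrightarrow> -1 \<le> x" "pi * x \<le> pi \<longleftrightarrow> x \<le> 1" for x
      using mult_le_cancel_left_pos[of pi "-1" x] mult_le_cancel_left_pos[of pi x 1] by simp_all
    then show ?thesis
      by (subst lborel_integral_real_affine[where c = pi and t = 0])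
         (auto intro!: Bochner_Integration.integral_cong split: split_indicator)
  qed
  also have "(LINT x|lborel. indicator {-1..1} x * P m n x) = integral {-1..1} (P m n)"
    using set_borel_integral_eq_integral(2)[OF borel_integrable_atLeastAtMost'[OF contP]]
    by (simp add: set_lebesgue_integral_def)
  also have "integral {-1..1} (P m n) = (if m = n then 2 / (2 * real n + 1) else 0)"
  proof -
    have "P m n = P n m" by (simp add: P_def[abs_def] mult.commute)
    then show ?thesis
      using legendre_orthogonal[of m n] legendre_orthogonal[of n m] legendre_norm[of n]
      unfolding P_def by (cases m n rule: linorder_cases) auto
  qed
  also have "c / (2 * pi) * (pi * (if m = n then 2 / (2 * real n + 1) else 0)) = (if m = n then 1 else 0)"
  proof -
    have "c = 2 * real n + 1" if "m = n" using that by (simp add: c_def)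
    moreover have "2 * real n + 1 > 0" by simp
    ultimately show ?thesis by (simp add: divide_eq_eq)
  qed
  finally show ?thesis .
qed

lemma degree_legendre_normalized: "degree (legendre_normalized n) = n"
  by (simp add: legendre_normalized_def degree_legendre degree_pcompose)

lemma legendre_normalized_nonzero: "legendre_normalized n \<noteq> 0"
proof
  assume "legendre_normalized n = 0"
  then show False using legendre_normalized_orthonormal[of n n] by simp
qed

lemma poly_approximation:
  fixes w :: "real \<Rightarrow> real"
  assumes "continuous_on {a..b} w" "\<epsilon> > 0"
  obtains q where "\<And>x. x \<in> {a..b} \<Longrightarrow> \<bar>w x - poly q x\<bar> < \<epsilon>"
proof -
  obtain g where g: "real_polynomial_function g" "\<And>x. x \<in> {a..b} \<Longrightarrow> \<bar>w x - g x\<bar> < \<epsilon>"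
    using Stone_Weierstrass_real_polynomial_function[OF compact_Icc assms] by blast
  then obtain a n where g': "g = (\<lambda>x. \<Sum>i\<le>n. a i * x ^ i)"
    unfolding real_polynomial_function_iff_sum by blast
  show ?thesis
    by (rule that[of "\<Sum>i\<le>n. monom (a i) i"]) (use g(2) g' in \<open>simp add: poly_sum poly_monom\<close>)
qed

text \<open>
  A continuous function \<open>w\<^sub>k\<close> close to \<open>u\<close> in the square mean is uniformly close to a polynomial on the
  band, and that polynomial is a finite combination of Legendre polynomials.
\<close>

lemma legendre_parseval_real:
  assumes lim: "L2_tendsto band w u" and cont: "\<And>k. continuous_on UNIV (w k)"
  shows "(\<lambda>n. (LINT \<omega>|band. u \<omega> * poly (legendre_normalized n) \<omega>)\<^sup>2) sums (LINT \<omega>|band. (u \<omega>)\<^sup>2)"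
proof (rule orthonormal_parseval)
  interpret prob_space band by (rule prob_space_band)
  have si: "square_integrable band (w k)" "square_integrable band u" for k
    using lim by (auto simp: L2_tendsto_def)
  show "square_integrable band u" by fact
  have sq: "square_integrable band (poly q)" for q :: "real poly"
    by (intro square_integrable_band_continuous continuous_intros)
  then show "square_integrable band (poly (legendre_normalized n))" for n .
  fix \<epsilon> :: real assume \<epsilon>: "\<epsilon> > 0"
  have "(\<lambda>k. LINT \<omega>|band. (norm (w k \<omega> - u \<omega>))\<^sup>2) \<longlonglongrightarrow> 0"
    using lim by (simp add: L2_tendsto_def)
  then have "eventually (\<lambda>k. (LINT \<omega>|band. (norm (w k \<omega> - u \<omega>))\<^sup>2) < \<epsilon> / 4) sequentially"
    by (rule order_tendstoD) (use \<epsilon> in simp)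
  then obtain k where k: "(LINT \<omega>|band. (norm (w k \<omega> - u \<omega>))\<^sup>2) < \<epsilon> / 4"
    by (auto simp: eventually_sequentially)
  have "continuous_on {-pi..pi} (w k)" using cont continuous_on_subset by blast
  \<comment> \<open>uniform distance \<open>sqrt (\<epsilon> / 4)\<close> has square mean at most \<open>\<epsilon> / 4\<close>, as the measure has total mass one\<close>
  then obtain q where q: "\<And>x. x \<in> {-pi..pi} \<Longrightarrow> \<bar>w k x - poly q x\<bar> < sqrt (\<epsilon> / 4)"
    by (rule poly_approximation[of _ _ _ "sqrt (\<epsilon> / 4)"]) (use \<epsilon> in auto)
  obtain b where b: "q = (\<Sum>n<Suc (degree q). smult (b n) (legendre_normalized n))"
    using poly_span_of_degrees[of legendre_normalized, OF degree_legendre_normalized legendre_normalized_nonzero, of q "Suc (degree q)"] by auto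
  have bound: "AE \<omega> in band. (w k \<omega> - poly q \<omega>)\<^sup>2 \<le> \<epsilon> / 4"
    unfolding band_def
  proof (subst AE_density)
    have "(w k \<omega> - poly q \<omega>)\<^sup>2 \<le> \<epsilon> / 4" if "\<omega> \<in> {-pi..pi}" for \<omega>
      using power_mono[OF less_imp_le[OF q[OF that]], of 2] \<epsilon> by simp
    then show "AE x in lborel. 0 < ennreal (indicator {-pi..pi} x / (2 * pi)) \<longrightarrow> (w k x - poly q x)\<^sup>2 \<le> \<epsilon> / 4"
      by (intro AE_I2) (auto split: split_indicator)
  qed simp
  have i1: "integrable band (\<lambda>\<omega>. (u \<omega> - w k \<omega>)\<^sup>2)" and i2: "integrable band (\<lambda>\<omega>. (w k \<omega> - poly q \<omega>)\<^sup>2)"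
    and i3: "integrable band (\<lambda>\<omega>. (u \<omega> - poly q \<omega>)\<^sup>2)"
    using square_integrable_integrable[OF square_integrable_diff, OF si(2) si(1)]
      square_integrable_integrable[OF square_integrable_diff, OF si(1) sq]
      square_integrable_integrable[OF square_integrable_diff, OF si(2) sq] by simp_all
  have "(LINT \<omega>|band. (u \<omega> - poly q \<omega>)\<^sup>2) \<le> (LINT \<omega>|band. 2 * (u \<omega> - w k \<omega>)\<^sup>2 + 2 * (w k \<omega> - poly q \<omega>)\<^sup>2)"
  proof (rule integral_mono[OF i3])
    show "(u \<omega> - poly q \<omega>)\<^sup>2 \<le> 2 * (u \<omega> - w k \<omega>)\<^sup>2 + 2 * (w k \<omega> - poly q \<omega>)\<^sup>2" for \<omega>
      using norm_add_square_le[of "u \<omega> - w k \<omega>" "w k \<omega> - poly q \<omega>"] by simp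
  qed (use i1 i2 in simp)
  also have "\<dots> = 2 * (LINT \<omega>|band. (u \<omega> - w k \<omega>)\<^sup>2) + 2 * (LINT \<omega>|band. (w k \<omega> - poly q \<omega>)\<^sup>2)"
    using i1 i2 by simp
  also have "(LINT \<omega>|band. (w k \<omega> - poly q \<omega>)\<^sup>2) \<le> \<epsilon> / 4"
    by (rule integral_le_const[OF i2 bound])
  also have "(LINT \<omega>|band. (u \<omega> - w k \<omega>)\<^sup>2) < \<epsilon> / 4"
    using k by (simp add: power2_commute)
  finally have "(LINT \<omega>|band. (u \<omega> - poly q \<omega>)\<^sup>2) < \<epsilon>" by simp
  then have "(LINT \<omega>|band. (u \<omega> - (\<Sum>n<Suc (degree q). b n * poly (legendre_normalized n) \<omega>))\<^sup>2) < \<epsilon>"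
    by (subst (asm) b) (simp add: poly_sum)
  then show "\<exists>N b. (LINT \<omega>|band. (u \<omega> - (\<Sum>n<N. b n * poly (legendre_normalized n) \<omega>))\<^sup>2) < \<epsilon>" by blast
qed (rule legendre_normalized_orthonormal)

lemma L2_tendsto_band:
  fixes u :: "nat \<Rightarrow> real \<Rightarrow> 'b::{euclidean_space,real_normed_field}"
  assumes u: "L2_tendsto lborel u v"
  shows "L2_tendsto band u v"
proof -
  have si: "square_integrable lborel (u n)" "square_integrable lborel v" for n
    using u by (auto simp: L2_tendsto_def)
  have band_le: "integrable band w" "(LINT \<omega>|band. w \<omega>) \<le> 1 / (2 * pi) * (LINT \<omega>|lborel. w \<omega>)"
    if w: "integrable lborel w" "\<And>\<omega>. 0 \<le> w \<omega>" for w :: "real \<Rightarrow> real"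
  proof -
    have m: "w \<in> borel_measurable borel" using w by auto
    have si: "integrable lborel (\<lambda>\<omega>. indicator {-pi..pi} \<omega> *\<^sub>R w \<omega>)"
      using integrable_mult_indicator[OF _ w(1), of "{-pi..pi}"] by simp
    then show "integrable band w" by (simp add: integrable_band_iff[OF m] set_integrable_def)
    have "(LINT \<omega>|lborel. indicator {-pi..pi} \<omega> *\<^sub>R w \<omega>) \<le> (LINT \<omega>|lborel. w \<omega>)"
      by (rule integral_mono[OF si w(1)]) (auto simp: indicator_def w)
    then show "(LINT \<omega>|band. w \<omega>) \<le> 1 / (2 * pi) * (LINT \<omega>|lborel. w \<omega>)"
      by (simp add: integral_band[OF m] set_lebesgue_integral_def divide_right_mono)
  qed
  have sb: "square_integrable band w" if "square_integrable lborel w" for w :: "real \<Rightarrow> 'b"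
    using that band_le(1)[of "\<lambda>x. (norm (w x))\<^sup>2"] by (simp add: square_integrable_def)
  have "(\<lambda>n. 1 / (2 * pi) * (LINT \<omega>|lborel. (norm (u n \<omega> - v \<omega>))\<^sup>2)) \<longlonglongrightarrow> 1 / (2 * pi) * 0"
    using u by (intro tendsto_mult_left) (simp add: L2_tendsto_def)
  then have g: "(\<lambda>n. 1 / (2 * pi) * (LINT \<omega>|lborel. (norm (u n \<omega> - v \<omega>))\<^sup>2)) \<longlonglongrightarrow> 0" by simp
  have "norm (LINT \<omega>|band. (norm (u n \<omega> - v \<omega>))\<^sup>2) \<le> 1 / (2 * pi) * (LINT \<omega>|lborel. (norm (u n \<omega> - v \<omega>))\<^sup>2)" for n
    using band_le(2)[OF square_integrable_integrable[OF square_integrable_diff[OF si(1) si(2)]], of n] by simp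
  then have "(\<lambda>n. LINT \<omega>|band. (norm (u n \<omega> - v \<omega>))\<^sup>2) \<longlonglongrightarrow> 0"
    by (intro Lim_null_comparison[OF always_eventually g]) blast
  then show ?thesis unfolding L2_tendsto_def using sb si by blast
qed

lemma L2_tendsto_Re_mult:
  assumes u: "L2_tendsto M u v" and c: "c \<in> borel_measurable M" "\<And>x. cmod (c x) = 1"
  shows "L2_tendsto M (\<lambda>n x. Re (u n x * c x)) (\<lambda>x. Re (v x * c x))"
proof -
  have si: "square_integrable M (u n)" "square_integrable M v" for n
    using u by (auto simp: L2_tendsto_def)
  have re: "\<bar>Re (a * c x)\<bar> \<le> cmod a" for a x
    using abs_Re_le_cmod[of "a * c x"] c(2) by (simp add: norm_mult)
  have sre: "square_integrable M (\<lambda>x. Re (w x * c x))" if "square_integrable M w" for w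
  proof -
    have "w \<in> borel_measurable M" using that by auto
    with c(1) re show ?thesis
      unfolding square_integrable_def
      by (auto intro!: Bochner_Integration.integrable_bound[OF square_integrable_integrable[OF that]] power_mono
        simp flip: abs_le_square_iff)
  qed
  have "norm (LINT x|M. (norm (Re (u n x * c x) - Re (v x * c x)))\<^sup>2) \<le> (LINT x|M. (norm (u n x - v x))\<^sup>2)" for n
  proof -
    have "(LINT x|M. (norm (Re (u n x * c x) - Re (v x * c x)))\<^sup>2) \<le> (LINT x|M. (norm (u n x - v x))\<^sup>2)"
    proof (rule integral_mono)
      show "(norm (Re (u n x * c x) - Re (v x * c x)))\<^sup>2 \<le> (norm (u n x - v x))\<^sup>2" for x
        using re[of "u n x - v x" x] by (intro power_mono) (simp_all add: left_diff_distrib)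
    qed (intro square_integrable_integrable square_integrable_diff sre si)+
    then show ?thesis by simp
  qed
  moreover have g: "(\<lambda>n. LINT x|M. (norm (u n x - v x))\<^sup>2) \<longlonglongrightarrow> 0"
    using u by (simp add: L2_tendsto_def)
  ultimately have "(\<lambda>n. LINT x|M. (norm (Re (u n x * c x) - Re (v x * c x)))\<^sup>2) \<longlonglongrightarrow> 0"
    by (intro Lim_null_comparison[OF always_eventually g]) blast
  then show ?thesis
    unfolding L2_tendsto_def using sre si by blast
qed

text \<open>
  The real identity is applied to the real and to the imaginary part of \<open>v c\<close>. The factor \<open>c\<close> stands
  for \<open>e\<^sup>i\<^sup>\<omega>\<^sup>t\<close>; being unimodular it does not affect the sum.
\<close>

lemma legendre_parseval:
  assumes u: "L2_tendsto band u v" and cont: "\<And>n. continuous_on UNIV (u n)"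
    and c: "continuous_on UNIV c" "\<And>x. cmod (c x) = 1"
  shows "(\<lambda>n. (cmod (LINT \<omega>|band. v \<omega> * c \<omega> * of_real (poly (legendre_normalized n) \<omega>)))\<^sup>2)
    sums (LINT \<omega>|band. (cmod (v \<omega>))\<^sup>2)"
proof -
  have si: "square_integrable band v" using u by (auto simp: L2_tendsto_def)
  have [measurable]: "c \<in> borel_measurable borel" by (rule borel_measurable_continuous_onI[OF c(1)])
  have [measurable]: "v \<in> borel_measurable borel" using si by (simp add: square_integrable_def)
  have si': "square_integrable band (\<lambda>\<omega>. v \<omega> * c \<omega>)"
    using si c(2) by (simp add: square_integrable_def norm_mult)
  define p where "p n = poly (legendre_normalized n)" for n
  have int: "integrable band (\<lambda>\<omega>. v \<omega> * c \<omega> * of_real (p n \<omega>))" for n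
    unfolding p_def by (intro integrable_mult_square_integrable si' square_integrable_band_continuous continuous_intros)
  have re: "(\<lambda>n. (LINT \<omega>|band. Re (v \<omega> * d \<omega>) * p n \<omega>)\<^sup>2) sums (LINT \<omega>|band. (Re (v \<omega> * d \<omega>))\<^sup>2)"
    and ire: "integrable band (\<lambda>\<omega>. (Re (v \<omega> * d \<omega>))\<^sup>2)"
    if d: "continuous_on UNIV d" "\<And>x. cmod (d x) = 1" for d
  proof -
    have m: "d \<in> borel_measurable band"
      using borel_measurable_continuous_onI[OF d(1)] by simp
    note L = L2_tendsto_Re_mult[OF u m d(2)]
    show "(\<lambda>n. (LINT \<omega>|band. Re (v \<omega> * d \<omega>) * p n \<omega>)\<^sup>2) sums (LINT \<omega>|band. (Re (v \<omega> * d \<omega>))\<^sup>2)"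
      unfolding p_def by (rule legendre_parseval_real[OF L]) (intro continuous_intros cont d)
    show "integrable band (\<lambda>\<omega>. (Re (v \<omega> * d \<omega>))\<^sup>2)"
      using L by (simp add: L2_tendsto_def square_integrable_def)
  qed
  \<comment> \<open>multiplying by \<open>-\<i>\<close> turns imaginary parts into real parts\<close>
  define d where "d x = - \<i> * c x" for x
  have d: "continuous_on UNIV d" "\<And>x. cmod (d x) = 1"
    unfolding d_def by (intro continuous_intros c) (simp add: norm_mult c)
  have Im: "Re (v \<omega> * d \<omega>) = Im (v \<omega> * c \<omega>)" for \<omega> by (simp add: d_def)
  have "(cmod (LINT \<omega>|band. v \<omega> * c \<omega> * of_real (p n \<omega>)))\<^sup>2 =
     (LINT \<omega>|band. Re (v \<omega> * c \<omega>) * p n \<omega>)\<^sup>2 + (LINT \<omega>|band. Re (v \<omega> * d \<omega>) * p n \<omega>)\<^sup>2" for n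
  proof -
    have "Re (LINT \<omega>|band. v \<omega> * c \<omega> * of_real (p n \<omega>)) = (LINT \<omega>|band. Re (v \<omega> * c \<omega>) * p n \<omega>)"
      using integral_Re[OF int[of n]] by simp
    moreover have "Im (LINT \<omega>|band. v \<omega> * c \<omega> * of_real (p n \<omega>)) = (LINT \<omega>|band. Re (v \<omega> * d \<omega>) * p n \<omega>)"
      using integral_Im[OF int[of n]] unfolding Im by simp
    ultimately show ?thesis by (simp only: cmod_power2)
  qed
  moreover have "(LINT \<omega>|band. (cmod (v \<omega>))\<^sup>2) = (LINT \<omega>|band. (Re (v \<omega> * c \<omega>))\<^sup>2) + (LINT \<omega>|band. (Re (v \<omega> * d \<omega>))\<^sup>2)"
  proof -
    have "(cmod (v \<omega>))\<^sup>2 = (Re (v \<omega> * c \<omega>))\<^sup>2 + (Re (v \<omega> * d \<omega>))\<^sup>2" for \<omega>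
      using cmod_power2[of "v \<omega> * c \<omega>"] unfolding Im by (simp add: norm_mult c)
    then show ?thesis using ire[OF c] ire[OF d] by simp
  qed
  ultimately show ?thesis
    using sums_add[OF re[OF c] re[OF d]] by (simp add: p_def)
qed

section \<open>Fourier inversion for band-limited functions\<close>

lemma isCont_transform:
  assumes G: "integrable lborel (G :: real \<Rightarrow> complex)"
  shows "isCont (\<lambda>t. LINT \<omega>|lborel. G \<omega> * cis (\<omega> * t)) t"
proof (rule continuous_at_sequentiallyI)
  fix X assume X: "X \<longlonglongrightarrow> t"
  have [measurable]: "G \<in> borel_measurable borel" using G by auto
  show "(\<lambda>n. LINT \<omega>|lborel. G \<omega> * cis (\<omega> * X n)) \<longlonglongrightarrow> (LINT \<omega>|lborel. G \<omega> * cis (\<omega> * t))"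
  proof (rule integral_dominated_convergence[where w = "\<lambda>\<omega>. norm (G \<omega>)"])
    show "AE \<omega> in lborel. (\<lambda>n. G \<omega> * cis (\<omega> * X n)) \<longlonglongrightarrow> G \<omega> * cis (\<omega> * t)"
      by (intro AE_I2 tendsto_intros X)
  qed (use G in \<open>auto simp: norm_mult\<close>)
qed

text \<open>
  The indefinite integral from \<open>x - 1\<close> is constantly zero, and its derivative at \<open>x\<close> is \<open>\<psi>(x)\<close>.
\<close>

lemma continuous_zero_integrals:
  fixes \<psi> :: "real \<Rightarrow> complex"
  assumes cont: "continuous_on UNIV \<psi>" and zero: "\<And>a b. (LINT x:{a..b}|lborel. \<psi> x) = 0"
  shows "\<psi> x = 0"
proof -
  have sub: "continuous_on S \<psi>" for S using cont continuous_on_subset by blast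
  have "integral {x - 1..y} \<psi> = 0" for y
    using zero[of "x - 1" y] set_borel_integral_eq_integral(2)[OF borel_integrable_atLeastAtMost'[OF sub]] by simp
  then have "((\<lambda>y. 0) has_vector_derivative \<psi> x) (at x within {x - 1..x + 1})"
    using integral_has_vector_derivative[OF sub, of x "x - 1" "x + 1"] by simp
  moreover have "at x within {x - 1..x + 1} = at x"
    by (rule at_within_interior) simp
  ultimately have "((\<lambda>y. 0) has_vector_derivative \<psi> x) (at x)" by simp
  then show ?thesis
    by (rule vector_derivative_unique_at[OF _ has_vector_derivative_const])
qed

text \<open>
  On a set of finite measure square integrable functions are integrable, by multiplying with the
  indicator function.
\<close>

lemma integrable_band_supported:
  assumes F: "square_integrable lborel F" and supp: "\<And>\<omega>. \<omega> \<notin> {-pi..pi} \<Longrightarrow> F \<omega> = 0"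
  shows "integrable lborel (F :: real \<Rightarrow> complex)"
proof -
  have "square_integrable lborel (indicator {-pi..pi} :: real \<Rightarrow> complex)"
  proof -
    have "(\<lambda>x. (cmod (indicator {-pi..pi} x))\<^sup>2) = indicator {-pi..pi}"
      by (auto simp: indicator_def)
    then show ?thesis
      by (simp add: square_integrable_def emeasure_lborel_Icc_eq integrable_real_indicator)
  qed
  from integrable_mult_square_integrable[OF F this]
  show ?thesis
    by (rule Bochner_Integration.integrable_cong[OF refl, THEN iffD1, rotated]) (use supp in \<open>auto simp: indicator_def\<close>)
qed

text \<open>
  For an interval \<open>[a, b]\<close> with indicator function \<open>k\<close>, the weak identity and Fubini's theorem give
  \<open>2\<pi> \<integral>\<^sub>a\<^sup>b f = \<integral> F cnj k^ = \<integral>\<^sub>a\<^sup>b \<Phi>\<close>, where \<open>\<Phi>(t) = \<integral> F(\<omega>) e\<^sup>i\<^sup>\<omega>\<^sup>t d\<omega>\<close>. Continuity turns the equality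
  of all these integrals into equality everywhere.
\<close>

lemma band_inversion:
  assumes f: "continuous_on UNIV f" and F: "fourier_pair f F" and supp: "\<And>\<omega>. \<omega> \<notin> {-pi..pi} \<Longrightarrow> F \<omega> = 0"
  shows "complex_of_real (2 * pi * f t) = (LINT \<omega>|lborel. F \<omega> * cis (\<omega> * t))"
proof -
  have intF: "integrable lborel F"
    by (rule integrable_band_supported[OF fourier_pair_square_integrable(2)[OF F] supp])
  have [measurable]: "f \<in> borel_measurable borel" using f by (rule borel_measurable_continuous_onI)
  have [measurable]: "F \<in> borel_measurable borel" using intF by auto
  define \<Phi> where "\<Phi> t = (LINT \<omega>|lborel. F \<omega> * cis (\<omega> * t))" for t
  have cont: "continuous_on UNIV \<Phi>"
    unfolding \<Phi>_def by (intro continuous_at_imp_continuous_on ballI isCont_transform intF)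
  have contf: "continuous_on UNIV (\<lambda>x. complex_of_real (2 * pi * f x))" by (intro continuous_intros f)
  have "(LINT x:{a..b}|lborel. \<Phi> x - complex_of_real (2 * pi * f x)) = 0" for a b
  proof -
    define k where "k x = indicator {a..b} x * (1 :: real)" for x
    have k: "tame k" unfolding k_def by (rule tame_truncate) simp
    have [measurable]: "k \<in> borel_measurable borel" unfolding k_def by measurable
    have k1: "complex_of_real (k x) * c = indicator {a..b} x *\<^sub>R c" for x c
      by (simp add: k_def scaleR_conv_of_real)
    have "of_real (2 * pi * (LINT x|lborel. f x * k x)) = (LINT \<omega>|lborel. F \<omega> * cnj (fourier k \<omega>))"
      by (rule fourier_pair_weak[OF F k, symmetric])
    also have "\<dots> = (LINT \<omega>|lborel. LINT x|lborel. F \<omega> * (of_real (k x) * cis (\<omega> * x)))"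
      by (simp add: cnj_fourier)
    also have "\<dots> = (LINT x|lborel. LINT \<omega>|lborel. F \<omega> * (of_real (k x) * cis (\<omega> * x)))"
      by (rule Fubini_product_bound[of _ "\<lambda>\<omega>. cmod (F \<omega>)" "\<lambda>x. \<bar>k x\<bar>"])
         (use intF tame_integrable[OF k] in \<open>auto simp: norm_mult\<close>)
    also have "\<dots> = (LINT x|lborel. of_real (k x) * \<Phi> x)"
      by (simp add: \<Phi>_def mult.left_commute flip: integral_mult_right_zero)
    also have "\<dots> = (LINT x:{a..b}|lborel. \<Phi> x)"
      by (simp add: k1 set_lebesgue_integral_def)
    finally have eq: "(LINT x:{a..b}|lborel. \<Phi> x) = of_real (2 * pi * (LINT x|lborel. f x * k x))" ..
    have "(LINT x:{a..b}|lborel. complex_of_real (2 * pi * f x)) = (LINT x|lborel. of_real (2 * pi * (f x * k x)))"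
      unfolding set_lebesgue_integral_def k1[symmetric] by (simp add: mult_ac)
    also have "\<dots> = of_real (2 * pi * (LINT x|lborel. f x * k x))"
      unfolding integral_complex_of_real by simp
    finally have eq2: "(LINT x:{a..b}|lborel. complex_of_real (2 * pi * f x)) = \<dots>" .
    have "set_integrable lborel {a..b} \<Phi>" "set_integrable lborel {a..b} (\<lambda>x. complex_of_real (2 * pi * f x))"
      by (intro borel_integrable_atLeastAtMost' continuous_on_subset[OF cont subset_UNIV] continuous_on_subset[OF contf subset_UNIV])+
    then show ?thesis using eq eq2 by (simp only: set_integral_diff) simp
  qed
  from continuous_zero_integrals[OF continuous_on_diff[OF cont contf] this] show ?thesis
    by (simp add: \<Phi>_def)
qed

section \<open>Derivatives of band-limited functions\<close>

lemma cis_taylor_bound: "cmod (cis (\<omega> * y) - cis (\<omega> * t) - of_real (y - t) * (\<i> * of_real \<omega> * cis (\<omega> * t))) \<le> (\<omega> * (y - t))\<^sup>2"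
proof -
  define x where "x = \<omega> * (y - t)"
  have 1: "cis (\<omega> * y) = cis (\<omega> * t) * iexp x"
    unfolding cis_conv_exp[of x, symmetric] by (simp add: x_def cis_mult algebra_simps)
  have 2: "of_real (y - t) * (\<i> * of_real \<omega> * cis (\<omega> * t)) = cis (\<omega> * t) * (\<i> * of_real x)"
    by (simp add: x_def)
  have "cis (\<omega> * y) - cis (\<omega> * t) - of_real (y - t) * (\<i> * of_real \<omega> * cis (\<omega> * t)) =
     cis (\<omega> * t) * (iexp x - (1 + \<i> * of_real x))"
    unfolding 1 2 by (simp add: algebra_simps)
  then have "cmod (cis (\<omega> * y) - cis (\<omega> * t) - of_real (y - t) * (\<i> * of_real \<omega> * cis (\<omega> * t))) =
     cmod (iexp x - (1 + \<i> * of_real x))"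
    by (simp only: norm_mult norm_cis mult_1)
  also have "\<dots> \<le> \<bar>x\<bar>\<^sup>2 / 2"
    using iexp_approx1[of x 1] by (simp add: power2_eq_square)
  also have "\<dots> \<le> (\<omega> * (y - t))\<^sup>2" by (simp add: x_def)
  finally show ?thesis .
qed

lemma integrable_band_power:
  assumes G: "integrable lborel G" and supp: "\<And>\<omega>. \<omega> \<notin> {-pi..pi} \<Longrightarrow> G \<omega> = 0"
  shows "integrable lborel (\<lambda>\<omega>. G \<omega> * (\<i> * complex_of_real \<omega>) ^ k)"
proof (rule Bochner_Integration.integrable_bound)
  show "integrable lborel (\<lambda>\<omega>. pi ^ k * norm (G \<omega>))" using G by simp
  show "AE \<omega> in lborel. norm (G \<omega> * (\<i> * complex_of_real \<omega>) ^ k) \<le> norm (pi ^ k * norm (G \<omega>))"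
  proof (intro AE_I2)
    fix \<omega>
    have "\<bar>\<omega>\<bar> ^ k \<le> pi ^ k" if "\<omega> \<in> {-pi..pi}" using that by (intro power_mono) auto
    then show "norm (G \<omega> * (\<i> * complex_of_real \<omega>) ^ k) \<le> norm (pi ^ k * norm (G \<omega>))"
      using supp[of \<omega>] by (cases "\<omega> \<in> {-pi..pi}") (auto simp: norm_mult norm_power mult.commute[of "pi ^ k"] mult_left_mono)
  qed
qed (use G in measurable)

lemma integrable_mult_cis_complex:
  "integrable lborel G \<Longrightarrow> integrable lborel (\<lambda>\<omega>. G \<omega> * cis (\<omega> * t))"
  by (rule Bochner_Integration.integrable_bound[of _ G]) (auto simp: norm_mult)

text \<open>
  On the band \<open>|\<omega>| \<le> \<pi>\<close>, so the second-order Taylor bound for the kernel is uniform in \<open>\<omega>\<close>, and the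
  difference quotient differs from the claimed derivative by at most a multiple of \<open>|y - t|\<close>.
\<close>

lemma transform_has_vector_derivative:
  assumes G: "integrable lborel G" and supp: "\<And>\<omega>. \<omega> \<notin> {-pi..pi} \<Longrightarrow> G \<omega> = 0"
  shows "((\<lambda>t. LINT \<omega>|lborel. G \<omega> * cis (\<omega> * t)) has_vector_derivative
    (LINT \<omega>|lborel. G \<omega> * (\<i> * of_real \<omega>) * cis (\<omega> * t))) (at t)"
  unfolding has_vector_derivative_def
proof (rule has_derivativeI_sandwich[where e = 1])
  define \<Phi> where "\<Phi> t = (LINT \<omega>|lborel. G \<omega> * cis (\<omega> * t))" for t
  define D where "D = (LINT \<omega>|lborel. G \<omega> * (\<i> * of_real \<omega>) * cis (\<omega> * t))"
  define C where "C = pi\<^sup>2 * (LINT \<omega>|lborel. cmod (G \<omega>))"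
  show "bounded_linear (\<lambda>h. h *\<^sub>R D)" by (rule bounded_linear_scaleR_left)
  have [measurable]: "G \<in> borel_measurable borel" using G by auto
  have i: "integrable lborel (\<lambda>\<omega>. G \<omega> * (\<i> * of_real \<omega>) * cis (\<omega> * t))"
    using integrable_mult_cis_complex[OF integrable_band_power[OF G supp, of 1]] by simp
  note i' = integrable_mult_cis_complex[OF G]
  show "norm (\<Phi> y - \<Phi> t - (y - t) *\<^sub>R D) / norm (y - t) \<le> C * \<bar>y - t\<bar>" if "y \<noteq> t" for y
  proof -
    have "\<Phi> y - \<Phi> t - (y - t) *\<^sub>R D =
      (LINT \<omega>|lborel. G \<omega> * cis (\<omega> * y) - G \<omega> * cis (\<omega> * t) - (y - t) *\<^sub>R (G \<omega> * (\<i> * of_real \<omega>) * cis (\<omega> * t)))"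
      unfolding \<Phi>_def D_def using i i' by (simp del: scaleR_conv_of_real)
    also have "\<dots> = (LINT \<omega>|lborel. G \<omega> * (cis (\<omega> * y) - cis (\<omega> * t) - of_real (y - t) * (\<i> * of_real \<omega> * cis (\<omega> * t))))"
      by (simp add: scaleR_conv_of_real algebra_simps)
    also have "norm \<dots> \<le> (LINT \<omega>|lborel. (y - t)\<^sup>2 * pi\<^sup>2 * cmod (G \<omega>))"
    proof (rule order_trans[OF integral_norm_bound integral_mono_AE'])
      show "integrable lborel (\<lambda>\<omega>. (y - t)\<^sup>2 * pi\<^sup>2 * cmod (G \<omega>))" using G by simp
      show "AE \<omega> in lborel. norm (G \<omega> * (cis (\<omega> * y) - cis (\<omega> * t) - of_real (y - t) * (\<i> * of_real \<omega> * cis (\<omega> * t)))) \<le> (y - t)\<^sup>2 * pi\<^sup>2 * cmod (G \<omega>)"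
      proof (intro AE_I2)
        fix \<omega>
        have "cmod (cis (\<omega> * y) - cis (\<omega> * t) - of_real (y - t) * (\<i> * of_real \<omega> * cis (\<omega> * t))) \<le> (y - t)\<^sup>2 * pi\<^sup>2"
          if "\<omega> \<in> {-pi..pi}"
        proof -
          have "\<omega>\<^sup>2 \<le> pi\<^sup>2" using that by (intro abs_le_square_iff[THEN iffD1]) auto
          then have "(\<omega> * (y - t))\<^sup>2 \<le> (y - t)\<^sup>2 * pi\<^sup>2"
            by (simp add: power_mult_distrib mult.commute mult_right_mono)
          then show ?thesis using cis_taylor_bound order_trans by blast
        qed
        then show "norm (G \<omega> * (cis (\<omega> * y) - cis (\<omega> * t) - of_real (y - t) * (\<i> * of_real \<omega> * cis (\<omega> * t)))) \<le> (y - t)\<^sup>2 * pi\<^sup>2 * cmod (G \<omega>)"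
          using supp[of \<omega>] unfolding norm_mult[of "G \<omega>"] mult.commute[of "cmod (G \<omega>)"]
          by (cases "\<omega> \<in> {-pi..pi}") (auto intro: mult_right_mono)
      qed
    qed simp
    also have "\<dots> = C * \<bar>y - t\<bar> * \<bar>y - t\<bar>" by (simp add: C_def power2_eq_square)
    finally show ?thesis using that by (simp add: divide_le_eq)
  qed
  have "((\<lambda>y. C * \<bar>y - t\<bar>) \<longlongrightarrow> C * \<bar>t - t\<bar>) (at t)" by (intro tendsto_intros)
  then show "((\<lambda>y. C * \<bar>y - t\<bar>) \<longlongrightarrow> 0) (at t)" by simp
qed simp

text \<open>
  Each differentiation multiplies the transform by \<open>\<i> \<omega>\<close>. The derivative of a real function is the
  real part of the derivative of the integral, whose imaginary part is constantly zero.
\<close>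

lemma band_higher_deriv:
  assumes f: "continuous_on UNIV f" and F: "fourier_pair f F" and supp: "\<And>\<omega>. \<omega> \<notin> {-pi..pi} \<Longrightarrow> F \<omega> = 0"
  shows "complex_of_real (2 * pi * (deriv ^^ k) f t) = (LINT \<omega>|lborel. F \<omega> * (\<i> * of_real \<omega>) ^ k * cis (\<omega> * t))"
proof (induction k arbitrary: t)
  case 0
  show ?case using band_inversion[OF assms] by simp
next
  case (Suc k)
  define \<Phi> where "\<Phi> t = (LINT \<omega>|lborel. F \<omega> * (\<i> * of_real \<omega>) ^ k * cis (\<omega> * t))" for t
  define D where "D = (LINT \<omega>|lborel. F \<omega> * (\<i> * of_real \<omega>) ^ Suc k * cis (\<omega> * t))"
  have intF: "integrable lborel F"
    by (rule integrable_band_supported[OF fourier_pair_square_integrable(2)[OF F] supp])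
  have \<Phi>: "\<Phi> s = of_real (2 * pi * (deriv ^^ k) f s)" for s using Suc[of s] by (simp add: \<Phi>_def)
  have der: "(\<Phi> has_vector_derivative D) (at t)"
    using transform_has_vector_derivative[OF integrable_band_power[OF intF supp, of k], of t] supp
    by (simp add: \<Phi>_def[abs_def] D_def mult.assoc power_Suc2 del: power_Suc)
  have "((\<lambda>s. Re (\<Phi> s)) has_vector_derivative Re D) (at t)" "((\<lambda>s. Im (\<Phi> s)) has_vector_derivative Im D) (at t)"
    using der by (auto intro: bounded_linear.has_vector_derivative[OF bounded_linear_Re]
        bounded_linear.has_vector_derivative[OF bounded_linear_Im])
  then have re: "((\<lambda>s. 2 * pi * (deriv ^^ k) f s) has_real_derivative Re D) (at t)"
    and im: "((\<lambda>s. 0) has_real_derivative Im D) (at t)"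
    by (simp_all add: \<Phi> has_real_derivative_iff_has_vector_derivative)
  from im have "Im D = 0" using DERIV_unique DERIV_const by blast
  moreover have "2 * pi * deriv ((deriv ^^ k) f) t = Re D"
  proof -
    have "((\<lambda>s. (2 * pi * (deriv ^^ k) f s) / (2 * pi)) has_real_derivative Re D / (2 * pi)) (at t)"
      by (rule DERIV_cdivide[OF re])
    then have "((deriv ^^ k) f has_real_derivative Re D / (2 * pi)) (at t)" by simp
    from DERIV_imp_deriv[OF this] show ?thesis by simp
  qed
  ultimately show ?case unfolding D_def[symmetric] by (simp add: complex_eq_iff)
qed

section \<open>Chromatic derivatives of band-limited functions\<close>

text \<open>
  The factors \<open>(-\<i>)\<^sup>k\<close> of the operator cancel the \<open>(\<i> \<omega>)\<^sup>k\<close> coming from differentiation to \<open>\<omega>\<^sup>k\<close>, so that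
  the Legendre polynomial itself appears under the integral.
\<close>

lemma chromatic_derivative_band:
  assumes f: "continuous_on UNIV f" and F: "fourier_pair f F" and supp: "\<And>\<omega>. \<omega> \<notin> {-pi..pi} \<Longrightarrow> F \<omega> = 0"
  shows "chromatic_derivative n f t =
    \<i> ^ n * (LINT \<omega>|band. F \<omega> * cis (\<omega> * t) * of_real (poly (legendre_normalized n) \<omega>))"
proof -
  let ?p = "legendre_normalized n"
  have intF: "integrable lborel F"
    by (rule integrable_band_supported[OF fourier_pair_square_integrable(2)[OF F] supp])
  have [measurable]: "F \<in> borel_measurable borel" using intF by auto
  have int: "integrable lborel (\<lambda>\<omega>. F \<omega> * (\<i> * of_real \<omega>) ^ k * cis (\<omega> * t))" for k
    by (intro integrable_mult_cis_complex integrable_band_power intF supp)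
  have higher: "complex_of_real (2 * pi * (deriv ^^ k) f t) = (LINT \<omega>|lborel. F \<omega> * (\<i> * of_real \<omega>) ^ k * cis (\<omega> * t))" for k
    using f F supp by (rule band_higher_deriv)
  have pw0: "(- \<i>) ^ k * (\<i> * z) ^ k = z ^ k" for k z
    by (simp flip: power_mult_distrib)
  have pw: "of_real (coeff ?p k) * (- \<i>) ^ k * (F \<omega> * (\<i> * of_real \<omega>) ^ k * cis (\<omega> * t)) =
      F \<omega> * cis (\<omega> * t) * of_real (coeff ?p k * \<omega> ^ k)" for k \<omega>
  proof -
    have "of_real (coeff ?p k) * (- \<i>) ^ k * (F \<omega> * (\<i> * of_real \<omega>) ^ k * cis (\<omega> * t)) =
        F \<omega> * cis (\<omega> * t) * of_real (coeff ?p k) * ((- \<i>) ^ k * (\<i> * of_real \<omega>) ^ k)"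
      by (simp only: mult_ac)
    then show ?thesis unfolding pw0 by (simp add: mult_ac)
  qed
  have "(2 * pi) * (\<Sum>k\<le>degree ?p. of_real (coeff ?p k) * (- \<i>) ^ k * of_real ((deriv ^^ k) f t)) =
     (\<Sum>k\<le>degree ?p. of_real (coeff ?p k) * (- \<i>) ^ k * of_real (2 * pi * (deriv ^^ k) f t))"
    by (simp add: sum_distrib_left mult_ac)
  also have "\<dots> = (\<Sum>k\<le>degree ?p. LINT \<omega>|lborel. of_real (coeff ?p k) * (- \<i>) ^ k * (F \<omega> * (\<i> * of_real \<omega>) ^ k * cis (\<omega> * t)))"
    unfolding higher by simp
  also have "\<dots> = (LINT \<omega>|lborel. (\<Sum>k\<le>degree ?p. F \<omega> * cis (\<omega> * t) * of_real (coeff ?p k * \<omega> ^ k)))"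
    unfolding pw[symmetric] by (intro Bochner_Integration.integral_sum[symmetric] integrable_mult_right int)
  also have "\<dots> = (LINT \<omega>|lborel. F \<omega> * cis (\<omega> * t) * of_real (poly ?p \<omega>))"
    by (simp add: poly_altdef sum_distrib_left)
  also have "\<dots> = (LINT \<omega>:{-pi..pi}|lborel. F \<omega> * cis (\<omega> * t) * of_real (poly ?p \<omega>))"
    unfolding set_lebesgue_integral_def
    by (rule Bochner_Integration.integral_cong) (use supp in \<open>auto simp: indicator_def\<close>)
  also have "\<dots> = (2 * pi) * (LINT \<omega>|band. F \<omega> * cis (\<omega> * t) * of_real (poly ?p \<omega>))"
  proof -
    have "(\<lambda>\<omega>. complex_of_real (poly ?p \<omega>)) \<in> borel_measurable borel"
      by (intro borel_measurable_continuous_onI continuous_intros)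
    then show ?thesis by (subst integral_band) (auto simp: scaleR_conv_of_real)
  qed
  finally show ?thesis by (simp add: chromatic_derivative_def)
qed

text \<open>
  Like membership in \<open>BL_pi\<close>, but with the transform as an explicit argument that vanishes everywhere
  outside the band; sums and reflections then come with their transforms.
\<close>

definition bandlimited_pair :: "(real \<Rightarrow> real) \<Rightarrow> (real \<Rightarrow> complex) \<Rightarrow> bool" where
  "bandlimited_pair f F \<longleftrightarrow> continuous_on UNIV f \<and> fourier_pair f F \<and> (\<forall>\<omega>. \<omega> \<notin> {-pi..pi} \<longrightarrow> F \<omega> = 0)"

lemma bandlimited_pair_add:
  "bandlimited_pair f F \<Longrightarrow> bandlimited_pair g G \<Longrightarrow> bandlimited_pair (\<lambda>x. f x + g x) (\<lambda>\<omega>. F \<omega> + G \<omega>)"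
  unfolding bandlimited_pair_def by (auto intro: fourier_pair_add continuous_intros)

lemma bandlimited_pair_cmult:
  "bandlimited_pair f F \<Longrightarrow> bandlimited_pair (\<lambda>x. c * f x) (\<lambda>\<omega>. of_real c * F \<omega>)"
  unfolding bandlimited_pair_def by (auto intro: fourier_pair_cmult continuous_intros)

lemma bandlimited_pair_reflect:
  "bandlimited_pair f F \<Longrightarrow> bandlimited_pair (\<lambda>x. f (u - x)) (\<lambda>\<omega>. cis (- (\<omega> * u)) * cnj (F \<omega>))"
  unfolding bandlimited_pair_def
proof (elim conjE, intro conjI)
  assume "continuous_on UNIV f"
  then show "continuous_on UNIV (\<lambda>x. f (u - x))"
    by (rule continuous_on_compose2) (auto intro: continuous_intros)
qed (auto intro: fourier_pair_reflect)

lemma chromatic_derivative_bandlimited: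
  assumes "bandlimited_pair f F"
  shows "chromatic_derivative n f t =
    \<i> ^ n * (LINT \<omega>|band. F \<omega> * cis (\<omega> * t) * of_real (poly (legendre_normalized n) \<omega>))"
  using assms unfolding bandlimited_pair_def by (intro chromatic_derivative_band) auto

lemma bandlimited_pair_square_integrable:
  "bandlimited_pair f F \<Longrightarrow> square_integrable lborel f"
  unfolding bandlimited_pair_def by (auto intro: fourier_pair_square_integrable)

lemma integrable_bandlimited_legendre:
  assumes "bandlimited_pair f F"
  shows "integrable band (\<lambda>\<omega>. F \<omega> * cis (\<omega> * t) * of_real (poly (legendre_normalized n) \<omega>))"
proof -
  obtain h where "L2_tendsto lborel (\<lambda>n. fourier (h n)) F"
    using assms by (auto simp: bandlimited_pair_def fourier_pair_def)
  from L2_tendsto_band[OF this] have "square_integrable band F" by (simp add: L2_tendsto_def)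
  moreover have "square_integrable band (\<lambda>\<omega>. cis (\<omega> * t) * of_real (poly (legendre_normalized n) \<omega>))"
    by (intro square_integrable_band_continuous continuous_intros)
  ultimately show ?thesis
    unfolding mult.assoc by (rule integrable_mult_square_integrable)
qed

lemma chromatic_derivative_add_cmult:
  assumes f: "bandlimited_pair f F" and g: "bandlimited_pair g G"
  shows "chromatic_derivative n (\<lambda>x. f x + c * g x) t = chromatic_derivative n f t + of_real c * chromatic_derivative n g t"
proof -
  note fg = bandlimited_pair_add[OF f bandlimited_pair_cmult[OF g, of c]]
  have "(LINT \<omega>|band. (F \<omega> + of_real c * G \<omega>) * cis (\<omega> * t) * of_real (poly (legendre_normalized n) \<omega>)) =
    (LINT \<omega>|band. F \<omega> * cis (\<omega> * t) * of_real (poly (legendre_normalized n) \<omega>) +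
       of_real c * (G \<omega> * cis (\<omega> * t) * of_real (poly (legendre_normalized n) \<omega>)))"
    by (simp add: algebra_simps)
  also have "\<dots> = (LINT \<omega>|band. F \<omega> * cis (\<omega> * t) * of_real (poly (legendre_normalized n) \<omega>)) +
       of_real c * (LINT \<omega>|band. G \<omega> * cis (\<omega> * t) * of_real (poly (legendre_normalized n) \<omega>))"
    using integrable_bandlimited_legendre[OF f, of t n] integrable_bandlimited_legendre[OF g, of t n] by simp
  finally show ?thesis
    unfolding chromatic_derivative_bandlimited[OF f] chromatic_derivative_bandlimited[OF g] chromatic_derivative_bandlimited[OF fg]
    by (simp add: algebra_simps)
qed

text \<open>
  Parseval's identity for \<open>F(\<omega>) e\<^sup>i\<^sup>\<omega>\<^sup>t\<close> on the band, combined with Plancherel's identity on the line.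
  The square of the modulus of \<open>K\<^sup>n[f](t)\<close> is its square because the chromatic derivative is real.
\<close>

lemma chromatic_energy:
  assumes f: "bandlimited_pair f F"
  shows "(\<lambda>n. (chromatic_derivative n f t)\<^sup>2) sums complex_of_real (LINT x|lborel. (f x)\<^sup>2)"
proof -
  obtain h where h: "\<And>n. tame (h n)" "L2_tendsto lborel (\<lambda>n. fourier (h n)) F"
    using f by (auto simp: bandlimited_pair_def fourier_pair_def)
  have F: "fourier_pair f F" and supp: "\<And>\<omega>. \<omega> \<notin> {-pi..pi} \<Longrightarrow> F \<omega> = 0"
    using f by (auto simp: bandlimited_pair_def)
  have [measurable]: "F \<in> borel_measurable borel"
    using fourier_pair_square_integrable(2)[OF F] by (simp add: square_integrable_def)
  have "(\<lambda>n. (cmod (LINT \<omega>|band. F \<omega> * cis (\<omega> * t) * of_real (poly (legendre_normalized n) \<omega>)))\<^sup>2)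
    sums (LINT \<omega>|band. (cmod (F \<omega>))\<^sup>2)"
    by (rule legendre_parseval[OF L2_tendsto_band[OF h(2)]])
       (use continuous_on_fourier[OF tame_integrable[OF h(1)]] in \<open>auto intro!: continuous_intros\<close>)
  moreover have "(LINT \<omega>|band. (cmod (F \<omega>))\<^sup>2) = (LINT x|lborel. (f x)\<^sup>2)"
  proof -
    have "(LINT \<omega>:{-pi..pi}|lborel. (cmod (F \<omega>))\<^sup>2) = (LINT \<omega>|lborel. (cmod (F \<omega>))\<^sup>2)"
      unfolding set_lebesgue_integral_def
      by (rule Bochner_Integration.integral_cong) (use supp in \<open>auto simp: indicator_def\<close>)
    then show ?thesis
      by (subst integral_band) (simp_all add: plancherel_pair[OF F])
  qed
  moreover have "complex_of_real ((cmod (LINT \<omega>|band. F \<omega> * cis (\<omega> * t) * of_real (poly (legendre_normalized n) \<omega>)))\<^sup>2)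
     = (chromatic_derivative n f t)\<^sup>2" for n
  proof -
    let ?K = "chromatic_derivative n f t"
    have "cmod (LINT \<omega>|band. F \<omega> * cis (\<omega> * t) * of_real (poly (legendre_normalized n) \<omega>)) = cmod ?K"
      unfolding chromatic_derivative_bandlimited[OF f] by (simp add: norm_mult norm_power)
    moreover obtain r where "?K = of_real r" using chromatic_derivative_real[of n f t] by (elim Reals_cases)
    ultimately show ?thesis by simp
  qed
  ultimately show ?thesis
    using sums_of_real[where ?'a = complex] by fastforce
qed

text \<open>
  Polarization: \<open>4 a b = (a + b)\<^sup>2 - (a - b)\<^sup>2\<close>, applied to the chromatic derivatives on one side and
  to the functions on the other.
\<close>

lemma chromatic_inner_product:
  assumes f: "bandlimited_pair f F" and g: "bandlimited_pair g G"
  shows "(\<lambda>n. chromatic_derivative n f t * chromatic_derivative n g t) sums complex_of_real (LINT x|lborel. f x * g x)"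
proof -
  define K where "K n f = chromatic_derivative n f t" for n f
  note sf = bandlimited_pair_square_integrable[OF f] and sg = bandlimited_pair_square_integrable[OF g]
  have e: "(\<lambda>n. (K n f + of_real c * K n g)\<^sup>2) sums complex_of_real (LINT x|lborel. (f x + c * g x)\<^sup>2)" for c
    using chromatic_energy[OF bandlimited_pair_add[OF f bandlimited_pair_cmult[OF g, of c]], of t]
    by (simp add: chromatic_derivative_add_cmult[OF f g] K_def)
  have "(\<lambda>n. ((K n f + of_real 1 * K n g)\<^sup>2 - (K n f + of_real (-1) * K n g)\<^sup>2) / 4) sums
     ((complex_of_real (LINT x|lborel. (f x + 1 * g x)\<^sup>2) - complex_of_real (LINT x|lborel. (f x + (-1) * g x)\<^sup>2)) / 4)"
    by (intro sums_divide sums_diff e)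
  moreover have "((K n f + of_real 1 * K n g)\<^sup>2 - (K n f + of_real (-1) * K n g)\<^sup>2) / 4 = K n f * K n g" for n
    by (simp add: power2_eq_square algebra_simps)
  moreover have "(LINT x|lborel. (f x + 1 * g x)\<^sup>2) - (LINT x|lborel. (f x + (-1) * g x)\<^sup>2) = 4 * (LINT x|lborel. f x * g x)"
  proof -
    have i: "integrable lborel (\<lambda>x. (f x + c * g x)\<^sup>2)" for c
      using square_integrable_integrable[OF square_integrable_add[OF sf square_integrable_cmult[OF sg, of c]]] by simp
    have "(LINT x|lborel. (f x + 1 * g x)\<^sup>2) - (LINT x|lborel. (f x + (-1) * g x)\<^sup>2) =
      (LINT x|lborel. (f x + 1 * g x)\<^sup>2 - (f x + (-1) * g x)\<^sup>2)"
      by (rule Bochner_Integration.integral_diff[symmetric, OF i i])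
    also have "\<dots> = (LINT x|lborel. 4 * (f x * g x))"
      by (simp add: power2_eq_square algebra_simps)
    finally show ?thesis by simp
  qed
  then have "(complex_of_real (LINT x|lborel. (f x + 1 * g x)\<^sup>2) - complex_of_real (LINT x|lborel. (f x + (-1) * g x)\<^sup>2)) / 4 =
     complex_of_real (LINT x|lborel. f x * g x)"
    by (simp flip: of_real_diff)
  ultimately show ?thesis by (simp only: K_def)
qed

theorem proposition1p3:
  fixes f g :: "real \<Rightarrow> real"
  assumes "f \<in> BL_pi" and "g \<in> BL_pi"
  shows "(\<forall>t. (\<lambda>n. (chromatic_derivative n f t)\<^sup>2)
            sums complex_of_real (LINT x|lborel. (f x)\<^sup>2)) \<and>
         (\<forall>t. (\<lambda>n. chromatic_derivative n f t * chromatic_derivative n g t)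
            sums complex_of_real (LINT x|lborel. f x * g x)) \<and>
         (\<forall>u t. (\<lambda>n. chromatic_derivative n f t * chromatic_derivative n (\<lambda>s. g (u - s)) t)
            sums complex_of_real (LINT x|lborel. f x * g (u - x)))"
proof -
  obtain F where f: "bandlimited_pair f F"
    using BL_pi_fourier_pair[OF assms(1)] unfolding bandlimited_pair_def by metis
  obtain G where g: "bandlimited_pair g G"
    using BL_pi_fourier_pair[OF assms(2)] unfolding bandlimited_pair_def by metis
  show ?thesis
    using chromatic_energy[OF f] chromatic_inner_product[OF f g]
      chromatic_inner_product[OF f bandlimited_pair_reflect[OF g]]
    by blast
qed

end
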